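(* Let $E$ and $F$ be complex Banach spaces and $U$ an open subset of $E$. Then $\mathcal{H}^\infty(U,F^* )$ is isometrically isomorphic to $(\mathcal{G}^\infty(U)\widehat{\otimes}_HF)^*$, via $\Lambda\colon\mathcal{H}^\infty(U,F^* )\to(\mathcal{G}^\infty(U)\widehat{\otimes}_HF)^*$ given by $$\Lambda(f)(u)=\sum_{i=1}^n\lambda_i\langle f(x_i),y_i\rangle$$ for $f\in\mathcal{H}^\infty(U,F^* )$ and $u=\sum_{i=1}^n\lambda_i\delta(x_i)\otimes y_i\in\Delta(U)\otimes F$. Furthermore, its inverse is given by $$\langle\Lambda^{-1}(\varphi)(x),y\rangle=\langle\varphi,\delta(x)\otimes y\rangle$$ for $\varphi\in(\mathcal{G}^\infty(U)\widehat{\otimes}_HF)^*$, $x\in U$ and $y\in F$.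
   Context: $\mathcal{H}^\infty(U,G)$ is the Banach space of bounded holomorphic mappings $U\to G$ with the supremum norm, $\mathcal{H}^\infty(U)=\mathcal{H}^\infty(U,\mathbb{C})$. For $x\in U$, $\delta(x)\in\mathcal{H}^\infty(U)^*$ is evaluation at $x$; $\Delta(U)$ is the linear span of $\{\delta(x):x\in U\}$, and $\mathcal{G}^\infty(U)$ its norm closure in $\mathcal{H}^\infty(U)^*$. For $x\in U$, $y\in F$, $\delta(x)\otimes y$ acts on $\mathcal{H}^\infty(U,F^* )$ by $(\delta(x)\otimes y)(f)=\langle f(x),y\rangle$, and $\Delta(U)\otimes F$ is the linear span of these functionals. The norm $H$ on $\Delta(U)\otimes F$ is $H(u)=\sup\{|u(f)|:f\in\mathcal{H}^\infty(U,F^* ),\ \|f\|_\infty\leq1\}$. $\mathcal{G}^\infty(U)\widehat\otimes_HF$ denotes the Banach space in which $(\Delta(U)\otimes F,H)$ is a dense normed subspace, i.e. the completion of $(\Delta(U)\otimes F,H)$; $\Lambda(f)$ denotes the continuous linear functional determined by its values on $\Delta(U)\otimes F$. *)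

theory Defs
  imports "HOL-Analysis.Analysis" "HOL-Library.Function_Algebras"
begin

section \<open>Complex vector spaces and complex Banach spaces\<close>

class complex_vector = ab_group_add +
  fixes scaleC :: "complex \<Rightarrow> 'a \<Rightarrow> 'a" (infixr "*\<^sub>C" 75)
  assumes scaleC_add_right: "a *\<^sub>C (x + y) = a *\<^sub>C x + a *\<^sub>C y"
    and scaleC_add_left: "(a + b) *\<^sub>C x = a *\<^sub>C x + b *\<^sub>C x"
    and scaleC_scaleC: "a *\<^sub>C b *\<^sub>C x = (a * b) *\<^sub>C x"
    and scaleC_one: "1 *\<^sub>C x = x"

global_interpretation complex_vector:
  vector_space "scaleC :: complex \<Rightarrow> 'a \<Rightarrow> 'a::complex_vector"
  by unfold_locales
    (simp_all add: scaleC_add_right scaleC_add_left scaleC_scaleC scaleC_one)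

class complex_normed_vector = complex_vector + real_normed_vector +
  assumes scaleR_scaleC: "r *\<^sub>R x = complex_of_real r *\<^sub>C x"
    and norm_scaleC: "norm (a *\<^sub>C x) = cmod a * norm x"

class cbanach = complex_normed_vector + banach

instantiation complex :: cbanach
begin

definition scaleC_complex :: "complex \<Rightarrow> complex \<Rightarrow> complex"
  where "scaleC_complex a x = a * x"

instance
  by standard (simp_all add: scaleC_complex_def algebra_simps norm_mult scaleR_conv_of_real)

end

instantiation "fun" :: (type, complex_vector) complex_vector
begin

definition scaleC_fun :: "complex \<Rightarrow> ('a \<Rightarrow> 'b) \<Rightarrow> 'a \<Rightarrow> 'b"
  where "scaleC_fun a f = (\<lambda>x. a *\<^sub>C f x)"

instance
  by standard (simp_all add: scaleC_fun_def fun_eq_iff scaleC_add_right scaleC_add_left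
      scaleC_scaleC scaleC_one)

end

definition clinear_on :: "'a::complex_vector set \<Rightarrow> ('a \<Rightarrow> 'b::complex_vector) \<Rightarrow> bool"
  where "clinear_on S f \<longleftrightarrow>
    (\<forall>u\<in>S. \<forall>v\<in>S. f (u + v) = f u + f v) \<and> (\<forall>c. \<forall>u\<in>S. f (c *\<^sub>C u) = c *\<^sub>C f u)"


section \<open>The dual of a complex normed space, as a type\<close>

typedef (overloaded) 'a cdual =
  "{\<phi> :: 'a::complex_normed_vector \<Rightarrow> complex. bounded_linear \<phi> \<and> clinear_on UNIV \<phi>}"
  morphisms cdual_apply Abs_cdual
  by (rule exI[of _ "\<lambda>_. 0"]) (simp add: clinear_on_def bounded_linear_zero scaleC_complex_def)

setup_lifting type_definition_cdual

instantiation cdual :: (complex_normed_vector) complex_normed_vector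
begin

lift_definition norm_cdual :: "'a cdual \<Rightarrow> real" is onorm .

lift_definition zero_cdual :: "'a cdual" is "\<lambda>_. 0"
  by (simp add: clinear_on_def bounded_linear_zero scaleC_complex_def)

lift_definition plus_cdual :: "'a cdual \<Rightarrow> 'a cdual \<Rightarrow> 'a cdual" is "\<lambda>f g x. f x + g x"
  by (auto simp: clinear_on_def scaleC_complex_def algebra_simps intro: bounded_linear_add)

lift_definition minus_cdual :: "'a cdual \<Rightarrow> 'a cdual \<Rightarrow> 'a cdual" is "\<lambda>f g x. f x - g x"
  by (auto simp: clinear_on_def scaleC_complex_def algebra_simps intro: bounded_linear_sub)

lift_definition uminus_cdual :: "'a cdual \<Rightarrow> 'a cdual" is "\<lambda>f x. - f x"
  by (auto simp: clinear_on_def scaleC_complex_def algebra_simps intro: bounded_linear_minus)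

lift_definition scaleC_cdual :: "complex \<Rightarrow> 'a cdual \<Rightarrow> 'a cdual" is "\<lambda>c f x. c * f x"
  by (auto simp: clinear_on_def scaleC_complex_def algebra_simps
      intro: bounded_linear_const_mult)

definition scaleR_cdual :: "real \<Rightarrow> 'a cdual \<Rightarrow> 'a cdual"
  where "scaleR_cdual r f = complex_of_real r *\<^sub>C f"

definition dist_cdual :: "'a cdual \<Rightarrow> 'a cdual \<Rightarrow> real"
  where "dist_cdual f g = norm (f - g)"

definition sgn_cdual :: "'a cdual \<Rightarrow> 'a cdual"
  where "sgn_cdual f = inverse (norm f) *\<^sub>R f"

definition uniformity_cdual :: "('a cdual \<times> 'a cdual) filter"
  where [code del]: "uniformity_cdual = (INF e\<in>{0<..}. principal {(f, g). dist f g < e})"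

definition open_cdual :: "'a cdual set \<Rightarrow> bool"
  where [code del]: "open_cdual S = (\<forall>f\<in>S. \<forall>\<^sub>F (f', g) in uniformity. f' = f \<longrightarrow> g \<in> S)"

instance
proof
  have onorm_mult: "onorm (\<lambda>x. a * f x) = cmod a * onorm f"
    if f: "bounded_linear f" for a and f :: "'a \<Rightarrow> complex"
  proof (rule antisym)
    have le: "onorm (\<lambda>x. b * g x) \<le> cmod b * onorm g"
      if g: "bounded_linear g" for b and g :: "'a \<Rightarrow> complex"
    proof (rule onorm_bound)
      show "0 \<le> cmod b * onorm g" by (simp add: onorm_pos_le[OF g])
      show "cmod (b * g x) \<le> cmod b * onorm g * norm x" for x
        using onorm[OF g, of x] by (simp add: norm_mult mult.assoc mult_left_mono)
    qed
    show "onorm (\<lambda>x. a * f x) \<le> cmod a * onorm f" by (rule le[OF f])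
    show "cmod a * onorm f \<le> onorm (\<lambda>x. a * f x)"
    proof (cases "a = 0")
      case True
      then show ?thesis by (simp add: onorm_zero)
    next
      case False
      have "onorm (\<lambda>x. inverse a * (a * f x)) \<le> cmod (inverse a) * onorm (\<lambda>x. a * f x)"
        by (rule le) (intro bounded_linear_const_mult f)
      with False show ?thesis
        by (simp add: mult.assoc[symmetric] norm_inverse norm_divide field_simps)
    qed
  qed
  fix x y z :: "'a cdual" and a b :: complex and r s :: real
  show "x + y + z = x + (y + z)" "x + y = y + x" "0 + x = x" "- x + x = 0" "x - y = x + - y"
    by (transfer, simp add: add_ac)+
  show sc: "a *\<^sub>C (x + y) = a *\<^sub>C x + a *\<^sub>C y" "(a + b) *\<^sub>C x = a *\<^sub>C x + b *\<^sub>C x"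
    "a *\<^sub>C b *\<^sub>C x = (a * b) *\<^sub>C x" "1 *\<^sub>C x = x" for a b and x y :: "'a cdual"
    by (transfer, simp add: algebra_simps)+
  show "r *\<^sub>R x = complex_of_real r *\<^sub>C x" by (simp add: scaleR_cdual_def)
  show "r *\<^sub>R (x + y) = r *\<^sub>R x + r *\<^sub>R y" "(r + s) *\<^sub>R x = r *\<^sub>R x + s *\<^sub>R x"
    "r *\<^sub>R s *\<^sub>R x = (r * s) *\<^sub>R x" "1 *\<^sub>R x = x"
    by (simp_all add: scaleR_cdual_def sc)
  show "dist x y = norm (x - y)" by (rule dist_cdual_def)
  show "sgn x = inverse (norm x) *\<^sub>R x" by (rule sgn_cdual_def)
  show "uniformity = (INF e\<in>{0<..}. principal {(f, g :: 'a cdual). dist f g < e})"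
    by (rule uniformity_cdual_def)
  show "open U = (\<forall>f\<in>U. \<forall>\<^sub>F (f', g) in uniformity. f' = f \<longrightarrow> g \<in> U)" for U :: "'a cdual set"
    by (rule open_cdual_def)
  show "(norm x = 0) = (x = 0)" by transfer (auto simp: onorm_eq_0)
  show "norm (x + y) \<le> norm x + norm y" by transfer (auto intro: onorm_triangle)
  show nC: "norm (a *\<^sub>C x) = cmod a * norm x" for a and x :: "'a cdual"
    by transfer (simp add: onorm_mult)
  show "norm (r *\<^sub>R x) = \<bar>r\<bar> * norm x" by (simp add: scaleR_cdual_def nC)
qed

end


section \<open>Normed spaces given by a carrier and a norm function\<close>

text \<open>
  The spaces below depend on the open set \<open>U\<close> and hence are not types.  They are given by a
  subspace of an ambient complex vector space (usually one of functions, with pointwise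
  operations) together with a function that is a norm on this subspace.
\<close>

definition cnormed_space_on :: "'c::complex_vector set \<Rightarrow> ('c \<Rightarrow> real) \<Rightarrow> bool"
  where "cnormed_space_on C N \<longleftrightarrow>
    complex_vector.subspace C \<and>
    (\<forall>u\<in>C. 0 \<le> N u) \<and>
    (\<forall>u\<in>C. N u = 0 \<longleftrightarrow> u = 0) \<and>
    (\<forall>u\<in>C. \<forall>v\<in>C. N (u + v) \<le> N u + N v) \<and>
    (\<forall>c. \<forall>u\<in>C. N (c *\<^sub>C u) = cmod c * N u)"

definition cbanach_space_on :: "'c::complex_vector set \<Rightarrow> ('c \<Rightarrow> real) \<Rightarrow> bool"
  where "cbanach_space_on C N \<longleftrightarrow>
    cnormed_space_on C N \<and>
    (\<forall>X. (\<forall>n. X n \<in> C) \<and> (\<forall>e>0. \<exists>K. \<forall>m\<ge>K. \<forall>n\<ge>K. N (X m - X n) < e) \<longrightarrow>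
      (\<exists>u\<in>C. (\<lambda>n. N (X n - u)) \<longlonglongrightarrow> 0))"

text \<open>Functionals on \<open>C\<close> are represented by functions vanishing outside \<open>C\<close>.\<close>

definition dual_on :: "'c::complex_vector set \<Rightarrow> ('c \<Rightarrow> real) \<Rightarrow> ('c \<Rightarrow> complex) set"
  where "dual_on C N =
    {\<phi>. clinear_on C \<phi> \<and> (\<exists>K. \<forall>u\<in>C. cmod (\<phi> u) \<le> K * N u) \<and> (\<forall>u. u \<notin> C \<longrightarrow> \<phi> u = 0)}"

definition dual_norm :: "'c set \<Rightarrow> ('c \<Rightarrow> real) \<Rightarrow> ('c \<Rightarrow> complex) \<Rightarrow> real"
  where "dual_norm C N \<phi> = Sup {cmod (\<phi> u) | u. u \<in> C \<and> N u \<le> 1}"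

definition isometric_isomorphism ::
    "'b::complex_vector set \<Rightarrow> ('b \<Rightarrow> real) \<Rightarrow> 'c::complex_vector set \<Rightarrow> ('c \<Rightarrow> real) \<Rightarrow>
      ('b \<Rightarrow> 'c) \<Rightarrow> bool"
  where "isometric_isomorphism B N C M T \<longleftrightarrow>
    clinear_on B T \<and> bij_betw T B C \<and> (\<forall>u\<in>B. M (T u) = N u)"

text \<open>
  \<open>(C, M)\<close> is a completion of the normed space \<open>(S, N)\<close>, and \<open>\<iota>\<close> is the embedding of \<open>S\<close> as a
  dense normed subspace of \<open>C\<close>.
\<close>

definition is_completion ::
    "'b::complex_vector set \<Rightarrow> ('b \<Rightarrow> real) \<Rightarrow> 'c::complex_vector set \<Rightarrow> ('c \<Rightarrow> real) \<Rightarrow>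
      ('b \<Rightarrow> 'c) \<Rightarrow> bool"
  where "is_completion S N C M \<iota> \<longleftrightarrow>
    cbanach_space_on C M \<and>
    (\<forall>u\<in>S. \<iota> u \<in> C) \<and> clinear_on S \<iota> \<and> (\<forall>u\<in>S. M (\<iota> u) = N u) \<and>
    (\<forall>w\<in>C. \<forall>e>0. \<exists>u\<in>S. M (w - \<iota> u) < e)"


section \<open>Bounded holomorphic mappings and the space \<open>\<Delta>(U) \<otimes> F\<close>\<close>

definition cholomorphic_on ::
    "('e::complex_normed_vector \<Rightarrow> 'g::complex_normed_vector) \<Rightarrow> 'e set \<Rightarrow> bool"
  where "cholomorphic_on f U \<longleftrightarrow>
    (\<forall>x\<in>U. \<exists>D. clinear_on UNIV D \<and> (f has_derivative D) (at x))"

text \<open>A mapping \<open>U \<rightarrow> G\<close> is represented by its extension by \<open>0\<close> to the whole of \<open>E\<close>.\<close>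

definition Hinf :: "'e::complex_normed_vector set \<Rightarrow> ('e \<Rightarrow> 'g::complex_normed_vector) set"
  where "Hinf U =
    {f. cholomorphic_on f U \<and> bounded (f ` U) \<and> (\<forall>x. x \<notin> U \<longrightarrow> f x = 0)}"

text \<open>Inserting \<open>0\<close> only matters for \<open>U = {}\<close>, where the supremum must be \<open>0\<close>.\<close>

definition Hinf_norm :: "'e set \<Rightarrow> ('e \<Rightarrow> 'g::real_normed_vector) \<Rightarrow> real"
  where "Hinf_norm U f = Sup (insert 0 ((\<lambda>x. norm (f x)) ` U))"

text \<open>
  The functional \<open>\<delta>(x) \<otimes> y\<close> on the bounded holomorphic mappings from \<open>U\<close> to the dual of \<open>F\<close>; as
  in \<open>dual_on\<close>, functionals vanish outside their domain.
\<close>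

definition delta_tensor ::
    "'e::complex_normed_vector set \<Rightarrow> 'e \<Rightarrow> 'f::complex_normed_vector \<Rightarrow>
      ('e \<Rightarrow> 'f cdual) \<Rightarrow> complex"
  where "delta_tensor U x y = (\<lambda>f. if f \<in> Hinf U then cdual_apply (f x) y else 0)"

definition Delta_tensor ::
    "'e::complex_normed_vector set \<Rightarrow> (('e \<Rightarrow> 'f::complex_normed_vector cdual) \<Rightarrow> complex) set"
  where "Delta_tensor U = complex_vector.span {delta_tensor U x y | x y. x \<in> U}"

definition H_norm ::
    "'e::complex_normed_vector set \<Rightarrow> (('e \<Rightarrow> 'f::complex_normed_vector cdual) \<Rightarrow> complex) \<Rightarrow> real"
  where "H_norm U u = Sup {cmod (u f) | f. f \<in> Hinf U \<and> Hinf_norm U f \<le> 1}"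


section \<open>Existence of the completion\<close>

lemma dual_on_D:
  assumes "\<phi> \<in> dual_on C N"
  shows "clinear_on C \<phi>" "\<exists>K. \<forall>u\<in>C. cmod (\<phi> u) \<le> K * N u" "u \<notin> C \<Longrightarrow> \<phi> u = 0"
  using assms by (auto simp: dual_on_def)

lemma subspace_dual_on: "complex_vector.subspace (dual_on C N)"
proof -
  have "\<phi> + \<psi> \<in> dual_on C N" if \<phi>: "\<phi> \<in> dual_on C N" and \<psi>: "\<psi> \<in> dual_on C N" for \<phi> \<psi>
  proof -
    obtain K L where K: "\<And>u. u \<in> C \<Longrightarrow> cmod (\<phi> u) \<le> K * N u"
      and L: "\<And>u. u \<in> C \<Longrightarrow> cmod (\<psi> u) \<le> L * N u"
      using dual_on_D(2)[OF \<phi>] dual_on_D(2)[OF \<psi>] by blast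
    have "cmod (\<phi> u + \<psi> u) \<le> (K + L) * N u" if "u \<in> C" for u
      using norm_triangle_ineq[of "\<phi> u" "\<psi> u"] K[OF that] L[OF that]
      by (simp add: distrib_right)
    then have "\<exists>K. \<forall>u\<in>C. cmod (\<phi> u + \<psi> u) \<le> K * N u" by blast
    then show ?thesis
      using \<phi> \<psi> by (auto simp: dual_on_def clinear_on_def scaleC_complex_def algebra_simps)
  qed
  moreover have "c *\<^sub>C \<phi> \<in> dual_on C N" if \<phi>: "\<phi> \<in> dual_on C N" for c \<phi>
  proof -
    obtain K where K: "\<And>u. u \<in> C \<Longrightarrow> cmod (\<phi> u) \<le> K * N u"
      using dual_on_D(2)[OF \<phi>] by blast
    have "cmod (c * \<phi> u) \<le> (cmod c * K) * N u" if "u \<in> C" for u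
      using K[OF that] by (simp add: norm_mult mult.assoc mult_left_mono)
    then have "\<exists>K. \<forall>u\<in>C. cmod (c * \<phi> u) \<le> K * N u" by blast
    then show ?thesis
      using \<phi>
      by (auto simp: dual_on_def clinear_on_def scaleC_fun_def scaleC_complex_def algebra_simps)
  qed
  moreover have "0 \<in> dual_on C N"
    by (auto simp: dual_on_def clinear_on_def scaleC_complex_def intro!: exI[of _ 0])
  ultimately show ?thesis by (simp add: complex_vector.subspace_def)
qed

context
  fixes C :: "'c::complex_vector set" and N :: "'c \<Rightarrow> real"
  assumes norm_C: "cnormed_space_on C N"
begin

lemma dual_norm_bdd:
  assumes "\<phi> \<in> dual_on C N"
  shows "bdd_above {cmod (\<phi> u) | u. u \<in> C \<and> N u \<le> 1}"
proof -
  obtain K where K: "\<And>u. u \<in> C \<Longrightarrow> cmod (\<phi> u) \<le> K * N u"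
    using dual_on_D(2)[OF assms] by auto
  have "cmod (\<phi> u) \<le> \<bar>K\<bar>" if "u \<in> C" "N u \<le> 1" for u
  proof -
    have "0 \<le> N u" using norm_C that by (auto simp: cnormed_space_on_def)
    have "K * N u \<le> \<bar>K\<bar> * N u" using \<open>0 \<le> N u\<close> by (simp add: mult_right_mono)
    also have "\<dots> \<le> \<bar>K\<bar> * 1" using that by (intro mult_left_mono) auto
    finally show ?thesis using K[OF that(1)] by simp
  qed
  then show ?thesis by (auto simp: bdd_above_def)
qed

lemma dual_norm_upper:
  assumes "\<phi> \<in> dual_on C N" "u \<in> C" "N u \<le> 1"
  shows "cmod (\<phi> u) \<le> dual_norm C N \<phi>"
  unfolding dual_norm_def using assms by (intro cSup_upper dual_norm_bdd) auto

lemma zero_ball: "0 \<in> C" "N 0 = 0"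
  using norm_C by (auto simp: cnormed_space_on_def complex_vector.subspace_def)

lemma dual_norm_least:
  assumes "\<And>u. u \<in> C \<Longrightarrow> N u \<le> 1 \<Longrightarrow> cmod (\<phi> u) \<le> K"
  shows "dual_norm C N \<phi> \<le> K"
  unfolding dual_norm_def
proof (rule cSup_least)
  show "{cmod (\<phi> u) | u. u \<in> C \<and> N u \<le> 1} \<noteq> {}" using zero_ball by force
qed (use assms in auto)

lemma dual_norm_nonneg: "\<phi> \<in> dual_on C N \<Longrightarrow> 0 \<le> dual_norm C N \<phi>"
  using dual_norm_upper[of \<phi> 0] zero_ball order_trans[OF norm_ge_zero] by auto

lemma dual_norm_apply:
  assumes \<phi>: "\<phi> \<in> dual_on C N" and u: "u \<in> C"
  shows "cmod (\<phi> u) \<le> dual_norm C N \<phi> * N u"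
proof (cases "N u = 0")
  case True
  then show ?thesis using dual_on_D(2)[OF \<phi>] u by fastforce
next
  case False
  then have pos: "N u > 0" using norm_C u by (auto simp: cnormed_space_on_def less_le)
  let ?c = "complex_of_real (inverse (N u))"
  have "?c *\<^sub>C u \<in> C"
    using norm_C u by (auto simp: cnormed_space_on_def complex_vector.subspace_def)
  moreover have "N (?c *\<^sub>C u) = 1"
    using norm_C u pos False by (simp add: cnormed_space_on_def norm_inverse)
  ultimately have "cmod (\<phi> (?c *\<^sub>C u)) \<le> dual_norm C N \<phi>"
    by (intro dual_norm_upper \<phi>) auto
  moreover have "\<phi> (?c *\<^sub>C u) = ?c * \<phi> u"
    using dual_on_D(1)[OF \<phi>] u by (simp add: clinear_on_def scaleC_complex_def)
  ultimately have "inverse (N u) * cmod (\<phi> u) \<le> dual_norm C N \<phi>"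
    using pos by (simp add: norm_mult norm_inverse)
  then show ?thesis using pos by (simp add: field_simps)
qed

lemma cnormed_space_dual_on: "cnormed_space_on (dual_on C N) (dual_norm C N)"
proof -
  have eq0: "\<phi> = 0" if "\<phi> \<in> dual_on C N" "dual_norm C N \<phi> = 0" for \<phi>
  proof
    show "\<phi> u = 0 u" for u
      using dual_norm_apply[OF that(1), of u] dual_on_D(3)[OF that(1), of u] that(2)
      by (cases "u \<in> C") auto
  qed
  have "dual_norm C N 0 \<le> 0" by (rule dual_norm_least) simp
  moreover have "0 \<in> dual_on C N"
    using subspace_dual_on by (auto simp: complex_vector.subspace_def)
  ultimately have norm0: "dual_norm C N 0 = 0" using dual_norm_nonneg[of 0] by simp
  have tri: "dual_norm C N (\<phi> + \<psi>) \<le> dual_norm C N \<phi> + dual_norm C N \<psi>"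
    if "\<phi> \<in> dual_on C N" "\<psi> \<in> dual_on C N" for \<phi> \<psi>
  proof (rule dual_norm_least)
    fix u assume "u \<in> C" "N u \<le> 1"
    then show "cmod ((\<phi> + \<psi>) u) \<le> dual_norm C N \<phi> + dual_norm C N \<psi>"
      using norm_triangle_ineq[of "\<phi> u" "\<psi> u"] dual_norm_upper[OF that(1), of u]
        dual_norm_upper[OF that(2), of u] by simp
  qed
  have le: "dual_norm C N (c *\<^sub>C \<phi>) \<le> cmod c * dual_norm C N \<phi>" if "\<phi> \<in> dual_on C N" for c \<phi>
    by (rule dual_norm_least)
      (simp add: scaleC_fun_def scaleC_complex_def norm_mult mult_left_mono dual_norm_upper that)
  have "dual_norm C N (c *\<^sub>C \<phi>) = cmod c * dual_norm C N \<phi>" if \<phi>: "\<phi> \<in> dual_on C N" for c \<phi>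
  proof (cases "c = 0")
    case False
    have "dual_norm C N (inverse c *\<^sub>C c *\<^sub>C \<phi>) \<le> cmod (inverse c) * dual_norm C N (c *\<^sub>C \<phi>)"
      by (intro le complex_vector.subspace_scale[OF subspace_dual_on] \<phi>)
    then have "cmod c * dual_norm C N \<phi> \<le> dual_norm C N (c *\<^sub>C \<phi>)"
      using False by (simp add: scaleC_scaleC scaleC_one norm_inverse norm_divide field_simps)
    with le[OF \<phi>, of c] show ?thesis by simp
  qed (simp add: norm0)
  then show ?thesis
    unfolding cnormed_space_on_def
    using subspace_dual_on eq0 norm0 tri dual_norm_nonneg by blast
qed

lemma cbanach_space_dual_on: "cbanach_space_on (dual_on C N) (dual_norm C N)"
proof -
  let ?D = "dual_on C N" and ?M = "dual_norm C N"
  have "\<exists>\<phi>\<in>?D. (\<lambda>n. ?M (X n - \<phi>)) \<longlonglongrightarrow> 0"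
    if X: "\<And>n. X n \<in> ?D" and cau: "\<And>e. e > 0 \<Longrightarrow> \<exists>K. \<forall>m\<ge>K. \<forall>n\<ge>K. ?M (X m - X n) < e" for X
  proof -
    have diff: "X m - X n \<in> ?D" for m n
      by (rule complex_vector.subspace_diff[OF subspace_dual_on X X])
    have pt: "cmod (X m u - X n u) \<le> ?M (X m - X n) * N u" if "u \<in> C" for m n u
      using dual_norm_apply[OF diff that, of m n] by simp
    have conv: "convergent (\<lambda>n. X n u)" for u
    proof (cases "u \<in> C")
      case True
      then have "N u \<ge> 0" using norm_C by (auto simp: cnormed_space_on_def)
      have "Cauchy (\<lambda>n. X n u)"
      proof (rule metric_CauchyI)
        fix e :: real assume "e > 0"
        then have "e / (N u + 1) > 0" using \<open>N u \<ge> 0\<close> by simp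
        then obtain K where K: "\<And>m n. m \<ge> K \<Longrightarrow> n \<ge> K \<Longrightarrow> ?M (X m - X n) < e / (N u + 1)"
          using cau by blast
        have "dist (X m u) (X n u) < e" if "m \<ge> K" "n \<ge> K" for m n
        proof -
          have "dist (X m u) (X n u) \<le> ?M (X m - X n) * N u"
            using pt[OF True] by (simp add: dist_norm)
          also have "\<dots> \<le> ?M (X m - X n) * (N u + 1)"
            using dual_norm_nonneg[OF diff] by (simp add: distrib_left)
          also have "\<dots> < e" using K[OF that] \<open>N u \<ge> 0\<close> by (simp add: field_simps)
          finally show ?thesis .
        qed
        then show "\<exists>K. \<forall>m\<ge>K. \<forall>n\<ge>K. dist (X m u) (X n u) < e" by blast
      qed
      then show ?thesis by (rule Cauchy_convergent)
    next
      case False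
      then have "(\<lambda>n. X n u) = (\<lambda>n. 0)" using dual_on_D(3)[OF X] by auto
      then show ?thesis by (simp add: convergent_const)
    qed
    define \<phi> where "\<phi> = (\<lambda>u. lim (\<lambda>n. X n u))"
    have lim: "(\<lambda>n. X n u) \<longlonglongrightarrow> \<phi> u" for u
      using conv[of u] by (simp add: \<phi>_def convergent_LIMSEQ_iff)
    have close: "\<exists>K. \<forall>n\<ge>K. \<forall>u\<in>C. cmod (X n u - \<phi> u) \<le> e * N u" if e: "e > 0" for e
    proof -
      obtain K where K: "\<And>m n. m \<ge> K \<Longrightarrow> n \<ge> K \<Longrightarrow> ?M (X m - X n) < e"
        using cau[OF e] by blast
      have "cmod (X n u - \<phi> u) \<le> e * N u" if "n \<ge> K" "u \<in> C" for n u
      proof (rule LIMSEQ_le_const2)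
        show "(\<lambda>m. cmod (X n u - X m u)) \<longlonglongrightarrow> cmod (X n u - \<phi> u)"
          by (intro tendsto_intros lim)
        have "N u \<ge> 0" using norm_C that by (auto simp: cnormed_space_on_def)
        then have "cmod (X n u - X m u) \<le> e * N u" if "m \<ge> K" for m
          using pt[OF \<open>u \<in> C\<close>, of n m] K[OF \<open>n \<ge> K\<close> that]
          by (meson less_imp_le mult_right_mono order_trans)
        then show "\<exists>k. \<forall>m\<ge>k. cmod (X n u - X m u) \<le> e * N u" by blast
      qed
      then show ?thesis by blast
    qed
    have \<phi>: "\<phi> \<in> ?D"
    proof -
      have "\<phi> (u + v) = \<phi> u + \<phi> v" if "u \<in> C" "v \<in> C" for u v
      proof (rule LIMSEQ_unique[OF lim])
        have "(\<lambda>n. X n (u + v)) = (\<lambda>n. X n u + X n v)"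
          using dual_on_D(1)[OF X] that by (auto simp: clinear_on_def)
        then show "(\<lambda>n. X n (u + v)) \<longlonglongrightarrow> \<phi> u + \<phi> v" by (simp add: tendsto_add lim)
      qed
      moreover have "\<phi> (c *\<^sub>C u) = c *\<^sub>C \<phi> u" if "u \<in> C" for c u
      proof (rule LIMSEQ_unique[OF lim])
        have "(\<lambda>n. X n (c *\<^sub>C u)) = (\<lambda>n. c * X n u)"
          using dual_on_D(1)[OF X] that by (auto simp: clinear_on_def scaleC_complex_def)
        then show "(\<lambda>n. X n (c *\<^sub>C u)) \<longlonglongrightarrow> c *\<^sub>C \<phi> u"
          by (simp add: scaleC_complex_def tendsto_mult_left lim)
      qed
      moreover have "\<phi> u = 0" if "u \<notin> C" for u
        using dual_on_D(3)[OF X that] by (simp add: \<phi>_def)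
      moreover obtain n where "\<And>u. u \<in> C \<Longrightarrow> cmod (X n u - \<phi> u) \<le> 1 * N u"
        using close[of 1] by auto
      then have "cmod (\<phi> u) \<le> (?M (X n) + 1) * N u" if "u \<in> C" for u
        using that dual_norm_apply[OF X that, of n] norm_triangle_ineq4[of "X n u" "X n u - \<phi> u"]
        by (fastforce simp: distrib_right)
      ultimately show ?thesis unfolding dual_on_def clinear_on_def by blast
    qed
    have "(\<lambda>n. ?M (X n - \<phi>)) \<longlonglongrightarrow> 0"
    proof (rule LIMSEQ_I)
      fix e :: real assume "e > 0"
      then obtain K where K: "\<And>n u. n \<ge> K \<Longrightarrow> u \<in> C \<Longrightarrow> cmod (X n u - \<phi> u) \<le> e/2 * N u"
        using close[of "e/2"] by auto
      have "norm (?M (X n - \<phi>) - 0) < e" if "n \<ge> K" for n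
      proof -
        have "?M (X n - \<phi>) \<le> e/2"
        proof (rule dual_norm_least)
          fix u assume u: "u \<in> C" "N u \<le> 1"
          have "e/2 * N u \<le> e/2 * 1" using u \<open>e > 0\<close> by (intro mult_left_mono) auto
          then show "cmod ((X n - \<phi>) u) \<le> e/2" using K[OF that u(1)] by simp
        qed
        moreover have "0 \<le> ?M (X n - \<phi>)"
          by (intro dual_norm_nonneg complex_vector.subspace_diff[OF subspace_dual_on] X \<phi>)
        ultimately show ?thesis using \<open>e > 0\<close> by simp
      qed
      then show "\<exists>K. \<forall>n\<ge>K. norm (?M (X n - \<phi>) - 0) < e" by blast
    qed
    with \<phi> show ?thesis by blast
  qed
  then show ?thesis
    unfolding cbanach_space_on_def using cnormed_space_dual_on by blast
qed

end

lemma is_completion_closure: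
  assumes B: "cbanach_space_on B N" and S: "complex_vector.subspace S" "S \<subseteq> B"
  shows "is_completion S N {w \<in> B. \<forall>e>0. \<exists>u\<in>S. N (w - u) < e} N (\<lambda>u. u)"
proof -
  let ?C = "{w \<in> B. \<forall>e>0. \<exists>u\<in>S. N (w - u) < e}"
  note N = B[unfolded cbanach_space_on_def cnormed_space_on_def]
  have subB: "complex_vector.subspace B" using N by (elim conjE)
  have "\<forall>u\<in>B. 0 \<le> N u" using N by (elim conjE)
  then have nonneg: "0 \<le> N u" if "u \<in> B" for u using that by (rule bspec)
  have "\<forall>u\<in>B. \<forall>v\<in>B. N (u + v) \<le> N u + N v" using N by (elim conjE)
  then have tri: "N (u + v) \<le> N u + N v" if "u \<in> B" "v \<in> B" for u v using that by simp
  have "\<forall>c. \<forall>u\<in>B. N (c *\<^sub>C u) = cmod c * N u" using N by (elim conjE)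
  then have hom: "N (c *\<^sub>C u) = cmod c * N u" if "u \<in> B" for c u using that by simp
  have Bdiff: "u - v \<in> B" if "u \<in> B" "v \<in> B" for u v
    using that by (rule complex_vector.subspace_diff[OF subB])
  have N0: "N 0 = 0" "0 \<in> B" using N by (auto simp: complex_vector.subspace_def)
  have S_C: "S \<subseteq> ?C" using S(2) N0 by (auto intro!: bexI)
  have subC: "complex_vector.subspace ?C"
    unfolding complex_vector.subspace_def
  proof (intro conjI ballI allI)
    show "0 \<in> ?C" using S_C S(1) by (auto simp: complex_vector.subspace_def)
  next
    fix u v assume u: "u \<in> ?C" and v: "v \<in> ?C"
    have "\<exists>s\<in>S. N (u + v - s) < e" if "e > 0" for e
    proof -
      have "e/2 > 0" using that by simp
      then obtain s t where st: "s \<in> S" "t \<in> S" "N (u - s) < e/2" "N (v - t) < e/2"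
        using u v by blast
      have "N ((u - s) + (v - t)) < e"
      proof -
        have "u - s \<in> B" "v - t \<in> B" using st(1,2) u v S(2) by (auto intro: Bdiff)
        from tri[OF this] st(3,4) show ?thesis by simp
      qed
      moreover have "(u - s) + (v - t) = u + v - (s + t)" by simp
      ultimately show ?thesis
        using st S(1) by (metis complex_vector.subspace_add)
    qed
    then show "u + v \<in> ?C" using u v complex_vector.subspace_add[OF subB] by blast
  next
    fix c u assume u: "u \<in> ?C"
    have "\<exists>s\<in>S. N (c *\<^sub>C u - s) < e" if "e > 0" for e
    proof -
      have "e / (cmod c + 1) > 0" using that by (simp add: add_nonneg_pos)
      then obtain s where s: "s \<in> S" "N (u - s) < e / (cmod c + 1)" using u by blast
      have su: "u - s \<in> B" using u s S(2) by (auto intro: Bdiff)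
      then have "N (u - s) \<ge> 0" by (rule nonneg)
      have "N (c *\<^sub>C (u - s)) = cmod c * N (u - s)" by (rule hom[OF su])
      also have "\<dots> \<le> (cmod c + 1) * N (u - s)" using \<open>N (u - s) \<ge> 0\<close> by (simp add: distrib_right)
      also have "\<dots> < e" using s(2) pos_less_divide_eq[of "cmod c + 1" "N (u - s)" e]
        by (simp add: mult.commute add_nonneg_pos)
      finally have "N (c *\<^sub>C u - c *\<^sub>C s) < e"
        by (simp add: complex_vector.scale_right_diff_distrib)
      then show ?thesis using s S(1) by (metis complex_vector.subspace_scale)
    qed
    then show "c *\<^sub>C u \<in> ?C" using u complex_vector.subspace_scale[OF subB] by blast
  qed
  have lim: "\<exists>w\<in>?C. (\<lambda>n. N (X n - w)) \<longlonglongrightarrow> 0"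
    if X: "\<And>n. X n \<in> ?C" and cau: "\<forall>e>0. \<exists>K. \<forall>m\<ge>K. \<forall>n\<ge>K. N (X m - X n) < e" for X
  proof -
    have "\<forall>n. X n \<in> B" using X by blast
    then obtain w where w: "w \<in> B" "(\<lambda>n. N (X n - w)) \<longlonglongrightarrow> 0"
      using cau B unfolding cbanach_space_on_def by blast
    have "\<exists>s\<in>S. N (w - s) < e" if "e > 0" for e
    proof -
      have "e/2 > 0" using that by simp
      then obtain n where n: "norm (N (X n - w) - 0) < e/2"
        using LIMSEQ_D[OF w(2), of "e/2"] by blast
      obtain s where s: "s \<in> S" "N (X n - s) < e/2" using X[of n] \<open>e/2 > 0\<close> by blast
      have "N (w - X n) = N ((-1) *\<^sub>C (X n - w))"
        by (simp add: complex_vector.scale_minus_left scaleC_one)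
      also have "\<dots> = N (X n - w)" using hom[OF Bdiff, of "X n" w "-1"] X[of n] w(1)
        by (simp del: complex_vector.scale_minus_left)
      finally have "N (w - X n) < e/2" using n by simp
      moreover have "N ((w - X n) + (X n - s)) \<le> N (w - X n) + N (X n - s)"
        using X[of n] w(1) s(1) S(2) by (intro tri Bdiff) auto
      ultimately show ?thesis using s by (intro bexI[of _ s]) auto
    qed
    with w show ?thesis by blast
  qed
  have "\<forall>u\<in>B. N u = 0 \<longleftrightarrow> u = 0" using N by (elim conjE)
  then have "cnormed_space_on ?C N"
    unfolding cnormed_space_on_def using subC nonneg tri hom by simp
  then have "cbanach_space_on ?C N"
    unfolding cbanach_space_on_def using lim by blast
  then show ?thesis
    unfolding is_completion_def clinear_on_def using S_C by auto
qed

lemma cdual_apply_add [simp]: "cdual_apply (a + b) y = cdual_apply a y + cdual_apply b y"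
  by transfer simp

lemma cdual_apply_scaleC [simp]: "cdual_apply (c *\<^sub>C a) y = c * cdual_apply a y"
  by transfer simp

lemma norm_cdual_apply: "cmod (cdual_apply a y) \<le> norm a * norm y"
  by transfer (simp add: onorm)

lemma Hinf_norm_upper:
  assumes "f \<in> Hinf U"
  shows "norm (f x) \<le> Hinf_norm U f"
proof -
  have "bdd_above ((\<lambda>x. norm (f x)) ` U)"
    using assms by (auto simp: Hinf_def bounded_iff bdd_above_def)
  moreover have "norm (f x) \<in> insert 0 ((\<lambda>x. norm (f x)) ` U)"
    using assms by (auto simp: Hinf_def)
  ultimately show ?thesis unfolding Hinf_norm_def by (intro cSup_upper) auto
qed

lemma Hinf_norm_least: "0 \<le> K \<Longrightarrow> (\<And>x. x \<in> U \<Longrightarrow> norm (f x) \<le> K) \<Longrightarrow> Hinf_norm U f \<le> K"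
  unfolding Hinf_norm_def by (rule cSup_least) auto

lemma Hinf_norm_nonneg: "f \<in> Hinf U \<Longrightarrow> 0 \<le> Hinf_norm U f"
  by (rule order_trans[OF norm_ge_zero Hinf_norm_upper])

lemma bounded_linear_scaleC: "bounded_linear (\<lambda>x :: 'a::complex_normed_vector. c *\<^sub>C x)"
  by (rule bounded_linear_intro[of _ "cmod c"])
    (simp_all add: scaleC_add_right scaleR_scaleC scaleC_scaleC norm_scaleC mult.commute)

lemma cnormed_space_Hinf:
  "cnormed_space_on (Hinf U :: ('e::complex_normed_vector \<Rightarrow> 'g::complex_normed_vector) set)
    (Hinf_norm U)"
proof -
  let ?H = "Hinf U :: ('e \<Rightarrow> 'g) set"
  have add: "f + g \<in> ?H" if f: "f \<in> ?H" and g: "g \<in> ?H" for f g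
  proof -
    have "cholomorphic_on (f + g) U"
      unfolding cholomorphic_on_def
    proof
      fix x assume "x \<in> U"
      then obtain D D' where "clinear_on UNIV D" "(f has_derivative D) (at x)"
        "clinear_on UNIV D'" "(g has_derivative D') (at x)"
        using f g unfolding Hinf_def cholomorphic_on_def by blast
      then show "\<exists>D. clinear_on UNIV D \<and> (f + g has_derivative D) (at x)"
        by (intro exI[of _ "\<lambda>h. D h + D' h"])
          (auto simp: clinear_on_def scaleC_add_right plus_fun_def intro: has_derivative_add)
    qed
    moreover have "bounded ((f + g) ` U)"
      using f g bounded_plus_comp[of f U g] by (simp add: Hinf_def plus_fun_def)
    ultimately show ?thesis using f g by (auto simp: Hinf_def)
  qed
  have scale: "c *\<^sub>C f \<in> ?H" if f: "f \<in> ?H" for c f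
  proof -
    have "cholomorphic_on (c *\<^sub>C f) U"
      unfolding cholomorphic_on_def
    proof
      fix x assume "x \<in> U"
      then obtain D where "clinear_on UNIV D" "(f has_derivative D) (at x)"
        using f unfolding Hinf_def cholomorphic_on_def by blast
      then show "\<exists>D. clinear_on UNIV D \<and> (c *\<^sub>C f has_derivative D) (at x)"
        by (intro exI[of _ "\<lambda>h. c *\<^sub>C D h"])
          (auto simp: clinear_on_def scaleC_add_right scaleC_fun_def scaleC_scaleC mult.commute
            intro: bounded_linear.has_derivative[OF bounded_linear_scaleC])
    qed
    moreover have "bounded ((c *\<^sub>C f) ` U)"
      using f bounded_linear_image[OF _ bounded_linear_scaleC, of "f ` U" c]
      by (simp add: Hinf_def scaleC_fun_def image_image)
    ultimately show ?thesis using f by (auto simp: Hinf_def scaleC_fun_def)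
  qed
  have zero: "0 \<in> ?H"
  proof -
    have "cholomorphic_on (0 :: 'e \<Rightarrow> 'g) U"
      unfolding cholomorphic_on_def
      by (intro ballI exI[of _ "\<lambda>_. 0"]) (simp add: clinear_on_def zero_fun_def)
    then show ?thesis by (auto simp: Hinf_def bounded_iff)
  qed
  have norm0: "Hinf_norm U (0 :: 'e \<Rightarrow> 'g) = 0"
    by (intro antisym Hinf_norm_least Hinf_norm_nonneg zero) auto
  have eq0: "f = 0" if "f \<in> ?H" "Hinf_norm U f = 0" for f
    using Hinf_norm_upper[OF that(1)] that(2) by (auto simp: fun_eq_iff)
  have tri: "Hinf_norm U (f + g) \<le> Hinf_norm U f + Hinf_norm U g"
    if "f \<in> ?H" "g \<in> ?H" for f g
  proof (rule Hinf_norm_least)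
    show "norm ((f + g) x) \<le> Hinf_norm U f + Hinf_norm U g" for x
      using norm_triangle_ineq[of "f x" "g x"] Hinf_norm_upper[OF that(1), of x]
        Hinf_norm_upper[OF that(2), of x] by simp
  qed (use that in \<open>auto intro: add_nonneg_nonneg Hinf_norm_nonneg\<close>)
  have le: "Hinf_norm U (c *\<^sub>C f) \<le> cmod c * Hinf_norm U f" if "f \<in> ?H" for c f
    by (rule Hinf_norm_least)
      (simp_all add: scaleC_fun_def norm_scaleC mult_left_mono Hinf_norm_upper Hinf_norm_nonneg that)
  have hom: "Hinf_norm U (c *\<^sub>C f) = cmod c * Hinf_norm U f" if f: "f \<in> ?H" for c f
  proof (cases "c = 0")
    case False
    have "Hinf_norm U (inverse c *\<^sub>C c *\<^sub>C f) \<le> cmod (inverse c) * Hinf_norm U (c *\<^sub>C f)"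
      by (intro le scale f)
    then have "cmod c * Hinf_norm U f \<le> Hinf_norm U (c *\<^sub>C f)"
      using False by (simp add: scaleC_scaleC scaleC_one norm_inverse norm_divide field_simps)
    with le[OF f, of c] show ?thesis by simp
  qed (simp add: norm0)
  show ?thesis
    unfolding cnormed_space_on_def complex_vector.subspace_def
    using add scale zero norm0 eq0 tri hom Hinf_norm_nonneg by blast
qed

lemma subspace_Hinf: "complex_vector.subspace (Hinf U)"
  using cnormed_space_Hinf by (auto simp: cnormed_space_on_def)

lemma H_norm_eq_dual_norm: "H_norm U = dual_norm (Hinf U) (Hinf_norm U)"
  by (simp add: H_norm_def dual_norm_def fun_eq_iff)

lemma Delta_tensor_subset_dual:
  "(Delta_tensor U :: (('e::complex_normed_vector \<Rightarrow> 'f::complex_normed_vector cdual) \<Rightarrow> complex) set)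
    \<subseteq> dual_on (Hinf U) (Hinf_norm U)"
proof -
  have "delta_tensor U x y \<in> dual_on (Hinf U) (Hinf_norm U)" for x and y :: 'f
  proof -
    have "cmod (cdual_apply (f x) y) \<le> norm y * Hinf_norm U f" if "f \<in> Hinf U" for f
      using norm_cdual_apply[of "f x" y] mult_right_mono[OF Hinf_norm_upper[OF that, of x], of "norm y"]
      by (simp add: mult.commute)
    moreover have "f + g \<in> Hinf U" "c *\<^sub>C f \<in> Hinf U" if "f \<in> Hinf U" "g \<in> Hinf U"
      for c and f g :: "'e \<Rightarrow> 'f cdual"
      using that
      by (auto intro: complex_vector.subspace_add[OF subspace_Hinf]
          complex_vector.subspace_scale[OF subspace_Hinf])
    ultimately show ?thesis
      by (auto simp: dual_on_def delta_tensor_def clinear_on_def scaleC_complex_def scaleC_fun_def)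
  qed
  then show ?thesis
    unfolding Delta_tensor_def
    by (intro complex_vector.span_minimal subspace_dual_on) auto
qed

text \<open>
  \<open>(\<Delta>(U) \<otimes> F, H)\<close> has a completion, namely its closure in the dual of the space of bounded
  holomorphic mappings from \<open>U\<close> to the dual of \<open>F\<close>.
\<close>

lemma is_completion_Delta_tensor:
  fixes U :: "'e::complex_normed_vector set"
  defines "D \<equiv> dual_on (Hinf U :: ('e \<Rightarrow> 'f::complex_normed_vector cdual) set) (Hinf_norm U)"
  shows "is_completion (Delta_tensor U) (H_norm U)
    {w \<in> D. \<forall>e>0. \<exists>u\<in>Delta_tensor U. H_norm U (w - u) < e} (H_norm U) (\<lambda>u. u)"
  unfolding D_def H_norm_eq_dual_norm
  by (intro is_completion_closure cbanach_space_dual_on cnormed_space_Hinf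
      Delta_tensor_subset_dual)
    (simp add: Delta_tensor_def)

end

theory Submission
  imports Defs "HOL-Complex_Analysis.Cauchy_Integral_Formula"
begin

text \<open>
  A bounded holomorphic \<open>f\<close> defines on \<open>\<Delta>(U) \<otimes> F\<close> the functional \<open>u \<mapsto> u f\<close>, and \<open>\<bar>u f\<bar> \<le> \<parallel>f\<parallel> H(u)\<close>
  by the definition of \<open>H\<close>.  It therefore extends, uniquely and with norm at most \<open>\<parallel>f\<parallel>\<close>, to every
  completion (\<open>dual_on_completion_extend\<close>, \<open>dual_on_completion_eqI\<close>); this extension is \<open>\<Lambda>(f)\<close>.
  Since \<open>H(\<delta>(x) \<otimes> y) \<le> \<parallel>y\<parallel>\<close>, testing \<open>\<Lambda>(f)\<close> on the elements \<open>\<delta>(x) \<otimes> y\<close> gives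
  \<open>\<parallel>f\<parallel> \<le> \<parallel>\<Lambda>(f)\<parallel>\<close>, so that \<open>\<Lambda>\<close> is isometric.

  The substance is surjectivity: for a continuous functional \<open>\<phi>\<close>, the mapping
  \<open>f(x) = (y \<mapsto> \<phi>(\<delta>(x) \<otimes> y))\<close> from \<open>U\<close> to the dual of \<open>F\<close> is plainly bounded, but it has to be
  differentiable in norm.  Cauchy's inequalities on complex lines give, for \<open>g\<close> in the unit ball,
  bounds on \<open>Dg(x)h\<close> and on \<open>g(x + h) - g(x) - Dg(x)h\<close> that do not depend on \<open>g\<close>
  (\<open>Hinf_Cauchy_estimates\<close>).  In terms of functionals they say that
  \<open>\<delta>(x + h) \<otimes> y - \<delta>(x) \<otimes> y\<close> differs by \<open>O(\<parallel>h\<parallel>\<^sup>2)\<parallel>y\<parallel>\<close> in the norm \<open>H\<close> from the functional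
  \<open>T\<^sub>h\<^sub>,\<^sub>y : g \<mapsto> \<langle>Dg(x)h, y\<rangle>\<close>.  In particular \<open>T\<^sub>h\<^sub>,\<^sub>y\<close> is a limit of difference quotients, hence lies
  in the closure of \<open>\<Delta>(U) \<otimes> F\<close> in the dual of the space of bounded holomorphic mappings
  (\<open>derivative_functional_in_Delta_closure\<close>).  This closure is itself a completion, so \<open>\<phi>\<close>
  transfers to a functional \<open>\<Phi>\<close> on it; then \<open>h \<mapsto> (y \<mapsto> \<Phi>(T\<^sub>h\<^sub>,\<^sub>y))\<close> is the derivative of \<open>f\<close> at \<open>x\<close>,
  with linearity and the remainder estimate inherited through the linearity and continuity of \<open>\<Phi>\<close>.
  Going through the closure avoids a Hahn-Banach extension of \<open>\<phi>\<close> to the whole dual.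
\<close>

section \<open>Extending functionals from a dense subspace\<close>

lemma cnormed_space_onD:
  assumes "cnormed_space_on C N"
  shows "complex_vector.subspace C"
    and "u \<in> C \<Longrightarrow> 0 \<le> N u"
    and "u \<in> C \<Longrightarrow> v \<in> C \<Longrightarrow> N (u + v) \<le> N u + N v"
    and "u \<in> C \<Longrightarrow> N (c *\<^sub>C u) = cmod c * N u"
    and "N 0 = 0"
  using assms by (auto simp: cnormed_space_on_def complex_vector.subspace_def)

lemma cnormed_space_on_commute:
  assumes "cnormed_space_on C N" "u \<in> C" "v \<in> C"
  shows "N (u - v) = N (v - u)"
proof -
  have "v - u \<in> C"
    using assms by (intro complex_vector.subspace_diff cnormed_space_onD(1))
  from cnormed_space_onD(4)[OF assms(1) this, of "-1"] show ?thesis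
    by (simp add: complex_vector.scale_minus_left scaleC_one)
qed

lemma cnormed_space_on_triangle_diff:
  assumes C: "cnormed_space_on C N" and "u \<in> C" "v \<in> C" "w \<in> C"
  shows "N (u - v) \<le> N (w - u) + N (w - v)"
proof -
  have "N ((u - w) + (w - v)) \<le> N (u - w) + N (w - v)"
    using assms by (intro cnormed_space_onD(3)[OF C] complex_vector.subspace_diff cnormed_space_onD(1)[OF C])
  then show ?thesis
    using cnormed_space_on_commute[OF C, of u w] assms by simp
qed

lemma clinear_on_add: "clinear_on S p \<Longrightarrow> u \<in> S \<Longrightarrow> v \<in> S \<Longrightarrow> p (u + v) = p u + p v"
  and clinear_on_scale: "clinear_on S p \<Longrightarrow> u \<in> S \<Longrightarrow> p (c *\<^sub>C u) = c *\<^sub>C p u"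
  by (auto simp: clinear_on_def)

lemma clinear_on_diff:
  assumes "clinear_on S p" "complex_vector.subspace S" "u \<in> S" "v \<in> S"
  shows "p (u - v) = p u - p v"
proof -
  have "(-1) *\<^sub>C v \<in> S" using assms(2,4) by (rule complex_vector.subspace_scale)
  then have "p (u + (-1) *\<^sub>C v) = p u + (-1) *\<^sub>C p v"
    using assms by (simp only: clinear_on_add clinear_on_scale)
  then show ?thesis by (simp add: complex_vector.scale_minus_left scaleC_one)
qed

lemma clinear_on_zero:
  assumes "clinear_on S p" "complex_vector.subspace S"
  shows "p 0 = 0"
  using clinear_on_diff[OF assms, of 0 0] complex_vector.subspace_0[OF assms(2)] by simp

lemma clinear_on_span_eqI:
  assumes p: "clinear_on (complex_vector.span B) p" and q: "clinear_on (complex_vector.span B) q"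
    and eq: "\<And>b. b \<in> B \<Longrightarrow> p b = q b" and u: "u \<in> complex_vector.span B"
  shows "p u = q u"
proof -
  let ?E = "{u \<in> complex_vector.span B. p u = q u}"
  have "complex_vector.subspace ?E"
    unfolding complex_vector.subspace_def
    using p q clinear_on_zero[OF p] clinear_on_zero[OF q]
    by (auto simp: clinear_on_add clinear_on_scale complex_vector.span_zero
        complex_vector.span_add complex_vector.span_scale)
  then have "complex_vector.span B \<subseteq> ?E"
    by (intro complex_vector.span_minimal) (auto simp: eq complex_vector.span_base)
  with u show ?thesis by blast
qed

lemma is_completionD:
  assumes "is_completion S N C M \<iota>"
  shows "cnormed_space_on C M"
    and "u \<in> S \<Longrightarrow> \<iota> u \<in> C" "clinear_on S \<iota>" "u \<in> S \<Longrightarrow> M (\<iota> u) = N u"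
    and "w \<in> C \<Longrightarrow> e > 0 \<Longrightarrow> \<exists>u\<in>S. M (w - \<iota> u) < e"
  using assms by (auto simp: is_completion_def cbanach_space_on_def)

lemma dual_on_completion_eqI:
  assumes comp: "is_completion S N C M \<iota>"
    and \<phi>: "\<phi> \<in> dual_on C M" and \<psi>: "\<psi> \<in> dual_on C M"
    and eq: "\<And>u. u \<in> S \<Longrightarrow> \<phi> (\<iota> u) = \<psi> (\<iota> u)"
  shows "\<phi> = \<psi>"
proof
  fix w
  note C = is_completionD(1)[OF comp]
  show "\<phi> w = \<psi> w"
  proof (cases "w \<in> C")
    case True
    define \<theta> where "\<theta> = \<phi> - \<psi>"
    have \<theta>: "\<theta> \<in> dual_on C M"
      unfolding \<theta>_def by (rule complex_vector.subspace_diff[OF subspace_dual_on \<phi> \<psi>])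
    let ?K = "dual_norm C M \<theta>"
    have K: "0 \<le> ?K" by (rule dual_norm_nonneg[OF C \<theta>])
    have "cmod (\<theta> w) \<le> 0 + e" if "e > 0" for e
    proof -
      have "e / (?K + 1) > 0" using K that by simp
      then obtain u where u: "u \<in> S" "M (w - \<iota> u) < e / (?K + 1)"
        using is_completionD(5)[OF comp True] by blast
      have mem: "\<iota> u \<in> C" "w - \<iota> u \<in> C"
        using is_completionD(2)[OF comp u(1)] True
        by (auto intro: complex_vector.subspace_diff[OF cnormed_space_onD(1)[OF C]])
      have "\<theta> (w - \<iota> u) = \<theta> w"
        using clinear_on_diff[OF dual_on_D(1)[OF \<theta>] cnormed_space_onD(1)[OF C] True mem(1)]
          eq[OF u(1)] by (simp add: \<theta>_def)
      then have "cmod (\<theta> w) \<le> ?K * M (w - \<iota> u)"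
        using dual_norm_apply[OF C \<theta> mem(2)] by simp
      also have "\<dots> \<le> (?K + 1) * M (w - \<iota> u)"
        using cnormed_space_onD(2)[OF C mem(2)] by (simp add: distrib_right)
      also have "\<dots> \<le> e" using u(2) K by (simp add: field_simps)
      finally show ?thesis by simp
    qed
    then have "cmod (\<theta> w) \<le> 0" by (rule field_le_epsilon)
    then show ?thesis by (simp add: \<theta>_def)
  qed (simp add: dual_on_D(3)[OF \<phi>] dual_on_D(3)[OF \<psi>])
qed

text \<open>
  The extension \<open>\<phi>\<close> is
  characterised by \<open>\<bar>\<phi> w - \<psi> v\<bar> \<le> K M(w - \<iota> v)\<close> for all \<open>v\<close> in the dense subspace, and linearity
  follows by applying this estimate to approximations of the arguments.
\<close>

lemma dual_on_completion_extend:
  assumes comp: "is_completion S N C M \<iota>" and S: "complex_vector.subspace S"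
    and lin: "clinear_on S \<psi>" and bound: "\<And>u. u \<in> S \<Longrightarrow> cmod (\<psi> u) \<le> K * N u" and K: "0 \<le> K"
  shows "\<exists>\<phi>\<in>dual_on C M. (\<forall>u\<in>S. \<phi> (\<iota> u) = \<psi> u) \<and> dual_norm C M \<phi> \<le> K"
proof -
  note C = is_completionD(1)[OF comp]
  note \<iota>C = is_completionD(2)[OF comp]
  note dense = is_completionD(5)[OF comp]
  note subC = cnormed_space_onD(1)[OF C]
  note Cdiff = complex_vector.subspace_diff[OF subC]
  have bound_diff: "cmod (\<psi> u - \<psi> v) \<le> K * (M (w - \<iota> u) + M (w - \<iota> v))"
    if "u \<in> S" "v \<in> S" "w \<in> C" for u v w
  proof -
    have uv: "u - v \<in> S" using that S by (intro complex_vector.subspace_diff)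
    have "cmod (\<psi> u - \<psi> v) \<le> K * N (u - v)"
      using bound[OF uv] clinear_on_diff[OF lin S that(1,2)] by simp
    also have "N (u - v) = M (\<iota> u - \<iota> v)"
      using is_completionD(4)[OF comp uv]
        clinear_on_diff[OF is_completionD(3)[OF comp] S that(1,2)] by simp
    also have "\<dots> \<le> M (w - \<iota> u) + M (w - \<iota> v)"
      using that \<iota>C by (intro cnormed_space_on_triangle_diff[OF C])
    finally show ?thesis using K by (simp add: mult_left_mono)
  qed
  \<comment> \<open>The limit of \<open>\<psi>\<close> along one approximating sequence satisfies the estimate against every \<open>v\<close>.\<close>
  have "\<exists>z. \<forall>v\<in>S. cmod (z - \<psi> v) \<le> K * M (w - \<iota> v)" if w: "w \<in> C" for w
  proof -
    have "\<exists>u\<in>S. M (w - \<iota> u) < inverse (real (Suc n))" for n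
      by (rule dense[OF w]) simp
    then obtain u where u: "\<And>n. u n \<in> S" "\<And>n. M (w - \<iota> (u n)) < inverse (real (Suc n))"
      by metis
    have Mu: "(\<lambda>n. M (w - \<iota> (u n))) \<longlonglongrightarrow> 0"
    proof (rule tendsto_sandwich)
      show "\<forall>\<^sub>F n in sequentially. 0 \<le> M (w - \<iota> (u n))"
        using u(1) w \<iota>C by (auto intro!: always_eventually cnormed_space_onD(2)[OF C] Cdiff)
      show "\<forall>\<^sub>F n in sequentially. M (w - \<iota> (u n)) \<le> inverse (real (Suc n))"
        using u(2) by (auto intro!: always_eventually less_imp_le)
    qed (rule tendsto_const LIMSEQ_inverse_real_of_nat)+
    have "Cauchy (\<lambda>n. \<psi> (u n))"
    proof (rule metric_CauchyI)
      fix e :: real assume "e > 0"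
      then have "e / (2 * (K + 1)) > 0" using K by simp
      then obtain n0 where n0: "\<And>n. n \<ge> n0 \<Longrightarrow> M (w - \<iota> (u n)) < e / (2 * (K + 1))"
        using LIMSEQ_D[OF Mu, of "e / (2 * (K + 1))"] by (auto simp: abs_less_iff)
      have "dist (\<psi> (u m)) (\<psi> (u n)) < e" if "m \<ge> n0" "n \<ge> n0" for m n
      proof -
        have "0 \<le> M (w - \<iota> (u m)) + M (w - \<iota> (u n))"
          using u(1) w \<iota>C by (intro add_nonneg_nonneg cnormed_space_onD(2)[OF C] Cdiff) auto
        then have "dist (\<psi> (u m)) (\<psi> (u n)) \<le> (K + 1) * (M (w - \<iota> (u m)) + M (w - \<iota> (u n)))"
          using bound_diff[OF u(1) u(1) w, of m n] by (simp add: dist_norm distrib_right)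
        also have "\<dots> < (K + 1) * (e / (2 * (K + 1)) + e / (2 * (K + 1)))"
          using K n0[OF that(1)] n0[OF that(2)] by (intro mult_strict_left_mono) auto
        also have "\<dots> = e"
          using K nonzero_mult_div_cancel_left[of "2 * K + 2" e] by (simp add: algebra_simps)
        finally show ?thesis .
      qed
      then show "\<exists>n0. \<forall>m\<ge>n0. \<forall>n\<ge>n0. dist (\<psi> (u m)) (\<psi> (u n)) < e" by blast
    qed
    then obtain z where z: "(\<lambda>n. \<psi> (u n)) \<longlonglongrightarrow> z"
      using Cauchy_convergent convergent_def by blast
    have "cmod (z - \<psi> v) \<le> K * M (w - \<iota> v)" if v: "v \<in> S" for v
    proof (rule LIMSEQ_le)
      show "(\<lambda>n. cmod (\<psi> (u n) - \<psi> v)) \<longlonglongrightarrow> cmod (z - \<psi> v)"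
        by (intro tendsto_intros z)
      have "(\<lambda>n. K * (M (w - \<iota> (u n)) + M (w - \<iota> v))) \<longlonglongrightarrow> K * (0 + M (w - \<iota> v))"
        by (intro tendsto_intros Mu)
      then show "(\<lambda>n. K * (M (w - \<iota> (u n)) + M (w - \<iota> v))) \<longlonglongrightarrow> K * M (w - \<iota> v)" by simp
      show "\<exists>n0. \<forall>n\<ge>n0. cmod (\<psi> (u n) - \<psi> v) \<le> K * (M (w - \<iota> (u n)) + M (w - \<iota> v))"
        using bound_diff[OF u(1) v w] by blast
    qed
    then show ?thesis by blast
  qed
  then obtain \<phi>0 where \<phi>0: "\<And>w v. w \<in> C \<Longrightarrow> v \<in> S \<Longrightarrow> cmod (\<phi>0 w - \<psi> v) \<le> K * M (w - \<iota> v)"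
    by metis
  define \<phi> where "\<phi> w = (if w \<in> C then \<phi>0 w else 0)" for w
  have \<phi>: "cmod (\<phi> w - \<psi> v) \<le> K * M (w - \<iota> v)" if "w \<in> C" "v \<in> S" for w v
    using \<phi>0 that by (simp add: \<phi>_def)
  have approx: "\<exists>u\<in>S. L * M (w - \<iota> u) \<le> e" if w: "w \<in> C" and "e > 0" "L \<ge> 0" for w e L
  proof -
    have "e / (L + 1) > 0" using \<open>e > 0\<close> \<open>L \<ge> 0\<close> by simp
    then obtain u where u: "u \<in> S" "M (w - \<iota> u) < e / (L + 1)"
      using dense[OF w] by blast
    have "L * M (w - \<iota> u) \<le> (L + 1) * M (w - \<iota> u)"
      using cnormed_space_onD(2)[OF C Cdiff[OF w \<iota>C[OF u(1)]]] by (simp add: distrib_right)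
    also have "\<dots> \<le> e" using u(2) \<open>L \<ge> 0\<close> by (simp add: field_simps)
    finally show ?thesis using u(1) by blast
  qed
  have eq0: "z = 0" if "\<And>e. e > 0 \<Longrightarrow> cmod z \<le> e" for z
    using field_le_epsilon[of "cmod z" 0] that by simp
  have add: "\<phi> (w + w') = \<phi> w + \<phi> w'" if w: "w \<in> C" "w' \<in> C" for w w'
  proof -
    have "cmod (\<phi> (w + w') - \<phi> w - \<phi> w') \<le> e" if e: "e > 0" for e
    proof -
      obtain u where u: "u \<in> S" "2 * K * M (w - \<iota> u) \<le> e / 2"
        using approx[OF w(1), of "e / 2" "2 * K"] e K by auto
      obtain u' where u': "u' \<in> S" "2 * K * M (w' - \<iota> u') \<le> e / 2"
        using approx[OF w(2), of "e / 2" "2 * K"] e K by auto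
      have eq: "w + w' - \<iota> (u + u') = (w - \<iota> u) + (w' - \<iota> u')"
        using clinear_on_add[OF is_completionD(3)[OF comp] u(1) u'(1)] by simp
      have "M (w + w' - \<iota> (u + u')) \<le> M (w - \<iota> u) + M (w' - \<iota> u')"
        unfolding eq using w u(1) u'(1) \<iota>C by (intro cnormed_space_onD(3)[OF C] Cdiff)
      then have "K * M (w + w' - \<iota> (u + u')) \<le> K * (M (w - \<iota> u) + M (w' - \<iota> u'))"
        using K by (rule mult_left_mono)
      then have 1: "cmod (\<phi> (w + w') - \<psi> (u + u')) \<le> K * (M (w - \<iota> u) + M (w' - \<iota> u'))"
        using \<phi>[of "w + w'" "u + u'"] w u(1) u'(1)
        by (simp add: complex_vector.subspace_add[OF subC] complex_vector.subspace_add[OF S])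
      have "\<phi> (w + w') - \<phi> w - \<phi> w' =
          (\<phi> (w + w') - \<psi> (u + u')) - (\<phi> w - \<psi> u) - (\<phi> w' - \<psi> u')"
        using clinear_on_add[OF lin u(1) u'(1)] by simp
      also have "cmod \<dots> \<le> cmod (\<phi> (w + w') - \<psi> (u + u')) + cmod (\<phi> w - \<psi> u) + cmod (\<phi> w' - \<psi> u')"
        by (meson norm_triangle_ineq4 add_mono order_refl order_trans)
      also have "\<dots> \<le> K * (M (w - \<iota> u) + M (w' - \<iota> u')) + K * M (w - \<iota> u) + K * M (w' - \<iota> u')"
        using 1 \<phi>[OF w(1) u(1)] \<phi>[OF w(2) u'(1)] by linarith
      also have "\<dots> \<le> e" using u(2) u'(2) by (simp add: algebra_simps)
      finally show ?thesis .
    qed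
    then have "\<phi> (w + w') - \<phi> w - \<phi> w' = 0" by (rule eq0)
    then show ?thesis by (simp add: algebra_simps)
  qed
  have scale: "\<phi> (c *\<^sub>C w) = c *\<^sub>C \<phi> w" if w: "w \<in> C" for c w
  proof -
    have "cmod (\<phi> (c *\<^sub>C w) - c * \<phi> w) \<le> e" if e: "e > 0" for e
    proof -
      obtain u where u: "u \<in> S" "2 * K * cmod c * M (w - \<iota> u) \<le> e"
        using approx[OF w e, of "2 * K * cmod c"] K by auto
      have "c *\<^sub>C w - \<iota> (c *\<^sub>C u) = c *\<^sub>C (w - \<iota> u)"
        using clinear_on_scale[OF is_completionD(3)[OF comp] u(1)]
        by (simp add: complex_vector.scale_right_diff_distrib)
      then have "M (c *\<^sub>C w - \<iota> (c *\<^sub>C u)) = cmod c * M (w - \<iota> u)"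
        using w u(1) \<iota>C by (simp add: cnormed_space_onD(4)[OF C] Cdiff)
      then have 1: "cmod (\<phi> (c *\<^sub>C w) - \<psi> (c *\<^sub>C u)) \<le> K * (cmod c * M (w - \<iota> u))"
        using \<phi>[of "c *\<^sub>C w" "c *\<^sub>C u"] w u(1)
        by (simp add: complex_vector.subspace_scale[OF subC] complex_vector.subspace_scale[OF S])
      have "\<phi> (c *\<^sub>C w) - c * \<phi> w = (\<phi> (c *\<^sub>C w) - \<psi> (c *\<^sub>C u)) - c * (\<phi> w - \<psi> u)"
        using clinear_on_scale[OF lin u(1)] by (simp add: scaleC_complex_def algebra_simps)
      also have "cmod \<dots> \<le> cmod (\<phi> (c *\<^sub>C w) - \<psi> (c *\<^sub>C u)) + cmod c * cmod (\<phi> w - \<psi> u)"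
        by (metis norm_triangle_ineq4 norm_mult)
      also have "\<dots> \<le> K * (cmod c * M (w - \<iota> u)) + cmod c * (K * M (w - \<iota> u))"
        using 1 \<phi>[OF w u(1)] by (intro add_mono mult_left_mono) auto
      also have "\<dots> \<le> e" using u(2) by (simp add: algebra_simps)
      finally show ?thesis .
    qed
    then have "\<phi> (c *\<^sub>C w) - c * \<phi> w = 0" by (rule eq0)
    then show ?thesis by (simp add: scaleC_complex_def)
  qed
  \<comment> \<open>The defining estimate with \<open>v = 0\<close>.\<close>
  have bnd: "cmod (\<phi> w) \<le> K * M w" if "w \<in> C" for w
    using \<phi>[OF that complex_vector.subspace_0[OF S]] clinear_on_zero[OF lin S]
      clinear_on_zero[OF is_completionD(3)[OF comp] S] by simp
  have "\<phi> w = 0" if "w \<notin> C" for w using that by (simp add: \<phi>_def)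
  with add scale bnd have "\<phi> \<in> dual_on C M"
    unfolding dual_on_def clinear_on_def by blast
  moreover have "\<phi> (\<iota> u) = \<psi> u" if "u \<in> S" for u
    using \<phi>[OF \<iota>C[OF that] that] cnormed_space_onD(5)[OF C] by simp
  moreover have "dual_norm C M \<phi> \<le> K"
  proof (rule dual_norm_least[OF C])
    fix u assume "u \<in> C" "M u \<le> 1"
    then show "cmod (\<phi> u) \<le> K" using bnd[of u] mult_left_mono[of "M u" 1 K] K by simp
  qed
  ultimately show ?thesis by blast
qed


section \<open>Elements of the dual\<close>

lemma cdual_eqI: "(\<And>y. cdual_apply a y = cdual_apply b y) \<Longrightarrow> a = b"
  by (simp add: cdual_apply_inject[symmetric] fun_eq_iff)

lemma cdual_apply_diff: "cdual_apply (a - b) y = cdual_apply a y - cdual_apply b y"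
  by transfer simp

lemma cdual_apply_arg:
  "cdual_apply a (y + z) = cdual_apply a y + cdual_apply a z"
  "cdual_apply a (c *\<^sub>C y) = c * cdual_apply a y"
  by (transfer, simp add: clinear_on_def scaleC_complex_def)+

lemma norm_cdual_le:
  assumes "0 \<le> K" "\<And>y. cmod (cdual_apply a y) \<le> K * norm y"
  shows "norm a \<le> K"
  using assms by transfer (rule onorm_bound)

lemma bounded_linear_cdual_apply: "bounded_linear (\<lambda>a. cdual_apply a y)"
  by (rule bounded_linear_intro[of _ "norm y"])
    (simp_all add: scaleR_scaleC norm_cdual_apply scaleR_conv_of_real scaleC_complex_def)

lemma cdual_apply_Abs:
  assumes lin: "clinear_on UNIV q" and bnd: "\<And>y. cmod (q y) \<le> K * norm y"
  shows "cdual_apply (Abs_cdual q) = q"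
proof -
  have "bounded_linear q"
    using lin bnd
    by (intro bounded_linear_intro[of _ K])
      (simp_all add: clinear_on_def scaleR_scaleC mult.commute)
  with lin show ?thesis by (simp add: Abs_cdual_inverse)
qed


section \<open>Uniform Cauchy estimates\<close>

text \<open>
  On the unit disc the second derivative is at most \<open>2B/s\<^sup>2\<close>, because the disc of radius \<open>s > 1\<close>
  about each of its points stays inside the disc of radius \<open>2s\<close>; Taylor's formula from \<open>0\<close> to
  \<open>1\<close> then bounds the remainder.
\<close>

lemma holomorphic_first_order_remainder:
  fixes G :: "complex \<Rightarrow> complex"
  assumes hol: "G holomorphic_on ball 0 (2 * s)" and s: "1 < s"
    and B: "\<And>z. z \<in> ball 0 (2 * s) \<Longrightarrow> cmod (G z) \<le> B"
  shows "cmod (G 1 - G 0 - deriv G 0) \<le> 2 * B / s\<^sup>2"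
proof -
  have second: "cmod (deriv (deriv G) w) \<le> 2 * B / s\<^sup>2" if w: "w \<in> cball 0 1" for w
  proof -
    have sub: "cball w s \<subseteq> ball 0 (2 * s)"
    proof
      fix z assume "z \<in> cball w s"
      then have "norm (z - w) \<le> s" by (simp add: dist_norm norm_minus_commute)
      then show "z \<in> ball 0 (2 * s)"
        using w s norm_triangle_ineq[of "z - w" w] by simp
    qed
    have "cmod ((deriv ^^ 2) G w) \<le> fact 2 * B / s ^ 2"
    proof (rule Cauchy_inequality)
      show "G holomorphic_on ball w s"
        using hol sub ball_subset_cball by (meson holomorphic_on_subset order_trans)
      show "continuous_on (cball w s) G"
        using hol sub by (meson holomorphic_on_subset holomorphic_on_imp_continuous_on)
      show "cmod (G z) \<le> B" if "cmod (w - z) = s" for z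
        using that sub by (intro B) (auto simp: dist_norm)
    qed (use s in auto)
    then show ?thesis by (simp add: numeral_2_eq_2)
  qed
  have ders: "((deriv ^^ i) G has_field_derivative (deriv ^^ Suc i) G z) (at z within cball 0 1)"
    if "z \<in> cball 0 1" for i z
  proof -
    have "(deriv ^^ i) G holomorphic_on ball 0 (2 * s)"
      by (intro holomorphic_higher_deriv hol) simp
    then have "((deriv ^^ i) G has_field_derivative deriv ((deriv ^^ i) G) z) (at z)"
      using that s by (intro holomorphic_derivI[of _ "ball 0 (2 * s)"]) auto
    then show ?thesis by (simp add: has_field_derivative_at_within)
  qed
  have "cmod ((deriv ^^ 0) G 1 - (\<Sum>i\<le>1. (deriv ^^ i) G 0 * (1 - 0) ^ i / fact i))
      \<le> 2 * B / s\<^sup>2 * cmod (1 - 0) ^ Suc 1 / fact 1"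
    by (rule complex_Taylor[of "cball 0 1" 1 "\<lambda>i. (deriv ^^ i) G"]) (use ders second in simp_all)
  then show ?thesis by (simp add: algebra_simps)
qed

lemma Hinf_has_derivative:
  assumes g: "g \<in> Hinf U" and x: "x \<in> U"
  shows "(g has_derivative frechet_derivative g (at x)) (at x)"
    and "clinear_on UNIV (frechet_derivative g (at x))"
proof -
  obtain D where D: "clinear_on UNIV D" "(g has_derivative D) (at x)"
    using g x by (auto simp: Hinf_def cholomorphic_on_def)
  then have "D = frechet_derivative g (at x)" by (intro frechet_derivative_at)
  with D show "(g has_derivative frechet_derivative g (at x)) (at x)"
    and "clinear_on UNIV (frechet_derivative g (at x))" by simp_all
qed

lemma Hinf_restrict_to_line:
  fixes g :: "'e::complex_normed_vector \<Rightarrow> 'f::complex_normed_vector cdual"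
  assumes g: "g \<in> Hinf U" and z: "x + z *\<^sub>C h \<in> U"
  shows "((\<lambda>z. cdual_apply (g (x + z *\<^sub>C h)) y) has_field_derivative
    cdual_apply (frechet_derivative g (at (x + z *\<^sub>C h)) h) y) (at z)"
proof -
  let ?D = "frechet_derivative g (at (x + z *\<^sub>C h))"
  have "bounded_linear (\<lambda>z. z *\<^sub>C h)"
    by (rule bounded_linear_intro[of _ "norm h"])
      (simp_all add: scaleC_add_left scaleR_scaleC scaleC_scaleC scaleC_complex_def norm_scaleC)
  then have "((\<lambda>z. x + z *\<^sub>C h) has_derivative (\<lambda>k. k *\<^sub>C h)) (at z)"
    by (auto intro!: derivative_eq_intros bounded_linear_imp_has_derivative)
  from has_derivative_compose[OF this Hinf_has_derivative(1)[OF g z]]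
  have "((\<lambda>z. cdual_apply (g (x + z *\<^sub>C h)) y) has_derivative
      (\<lambda>k. cdual_apply (?D (k *\<^sub>C h)) y)) (at z)"
    by (rule bounded_linear.has_derivative[OF bounded_linear_cdual_apply])
  moreover have "(\<lambda>k. cdual_apply (?D (k *\<^sub>C h)) y) = (*) (cdual_apply (?D h) y)"
    using Hinf_has_derivative(2)[OF g z] by (auto simp: clinear_on_def mult.commute)
  ultimately show ?thesis by (simp add: has_field_derivative_def)
qed

text \<open>
  Restrict \<open>g\<close> to the complex line through \<open>x\<close> in direction \<open>h\<close> and pair it with \<open>y\<close>: this gives a
  scalar function on the disc of radius \<open>r/\<parallel>h\<parallel>\<close>, bounded by \<open>\<parallel>g\<parallel> \<parallel>y\<parallel>\<close>, whose derivative at \<open>0\<close> is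
  \<open>\<langle>Dg(x)h, y\<rangle>\<close>.  What matters for later is that \<open>g\<close> enters the bounds only through its norm.
\<close>

lemma Hinf_Cauchy_estimates:
  fixes g :: "'e::complex_normed_vector \<Rightarrow> 'f::complex_normed_vector cdual"
  assumes g: "g \<in> Hinf U" and r: "0 < r" "ball x r \<subseteq> U"
  shows "norm (frechet_derivative g (at x) h) \<le> 2 / r * norm h * Hinf_norm U g"
    and "norm h < r / 2 \<Longrightarrow>
      norm (g (x + h) - g x - frechet_derivative g (at x) h) \<le> 8 / r\<^sup>2 * (norm h)\<^sup>2 * Hinf_norm U g"
proof -
  have x: "x \<in> U" using r by auto
  let ?D = "frechet_derivative g (at x)"
  have D0: "?D 0 = 0"
    using clinear_on_zero[OF Hinf_has_derivative(2)[OF g x]] by simp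
  \<comment> \<open>The line meets the ball of radius \<open>r\<close> in a disc of radius \<open>2s\<close>; the condition on \<open>h\<close> in the
    second estimate means \<open>s > 1\<close>.\<close>
  define s where "s = r / (2 * norm h)"
  define G where "G y z = cdual_apply (g (x + z *\<^sub>C h)) y" for y z
  have on_line: "x + z *\<^sub>C h \<in> U" if "h \<noteq> 0" "z \<in> ball 0 (2 * s)" for z
  proof -
    have "cmod z * norm h < r" using that by (simp add: s_def field_simps)
    then show ?thesis using r(2) by (auto simp: dist_norm norm_scaleC)
  qed
  have der: "(G y has_field_derivative cdual_apply (frechet_derivative g (at (x + z *\<^sub>C h)) h) y) (at z)"
    if "h \<noteq> 0" "z \<in> ball 0 (2 * s)" for y z
    unfolding G_def[abs_def] using Hinf_restrict_to_line[OF g on_line[OF that]] .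
  have hol: "G y holomorphic_on ball 0 (2 * s)" if "h \<noteq> 0" for y
    unfolding holomorphic_on_open[OF open_ball] using der[OF that] by blast
  have bound: "cmod (G y z) \<le> Hinf_norm U g * norm y" for y z
    unfolding G_def
    by (rule order_trans[OF norm_cdual_apply mult_right_mono[OF Hinf_norm_upper[OF g]]]) simp
  have s0: "s > 0" if "h \<noteq> 0" using that r(1) by (simp add: s_def)
  have G0: "deriv (G y) 0 = cdual_apply (?D h) y" if "h \<noteq> 0" for y
    using DERIV_imp_deriv[OF der[OF that, of 0 y]] s0[OF that] by simp
  note nonneg = Hinf_norm_nonneg[OF g]
  show "norm (?D h) \<le> 2 / r * norm h * Hinf_norm U g"
  proof (cases "h = 0")
    case False
    show ?thesis
    proof (rule norm_cdual_le)
      fix y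
      have sub: "cball 0 s \<subseteq> ball 0 (2 * s)" using s0[OF False] by auto
      have "cmod ((deriv ^^ 1) (G y) 0) \<le> fact 1 * (Hinf_norm U g * norm y) / s ^ 1"
      proof (rule Cauchy_inequality)
        show "G y holomorphic_on ball 0 s"
          using hol[OF False] sub ball_subset_cball by (meson holomorphic_on_subset order_trans)
        show "continuous_on (cball 0 s) (G y)"
          using hol[OF False] sub by (meson holomorphic_on_subset holomorphic_on_imp_continuous_on)
      qed (use s0[OF False] bound in auto)
      then show "cmod (cdual_apply (?D h) y) \<le> 2 / r * norm h * Hinf_norm U g * norm y"
        using G0[OF False] by (simp add: s_def field_simps)
    qed (use r(1) nonneg in simp)
  qed (simp add: D0)
  show "norm (g (x + h) - g x - ?D h) \<le> 8 / r\<^sup>2 * (norm h)\<^sup>2 * Hinf_norm U g"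
    if h: "norm h < r / 2"
  proof (cases "h = 0")
    case False
    show ?thesis
    proof (rule norm_cdual_le)
      fix y
      have "1 < s" using False h by (simp add: s_def field_simps)
      from holomorphic_first_order_remainder[OF hol[OF False] this bound]
      have "cmod (G y 1 - G y 0 - deriv (G y) 0) \<le> 2 * (Hinf_norm U g * norm y) / s\<^sup>2" .
      then show "cmod (cdual_apply (g (x + h) - g x - ?D h) y)
          \<le> 8 / r\<^sup>2 * (norm h)\<^sup>2 * Hinf_norm U g * norm y"
        using G0[OF False]
        by (simp add: G_def scaleC_one cdual_apply_diff s_def power_divide power_mult_distrib field_simps)
    qed (use nonneg in simp)
  qed (simp add: D0)
qed


section \<open>The closure of \<open>\<Delta>(U) \<otimes> F\<close> in the dual of \<open>\<H>\<^sup>\<infinity>(U, F\<^sup>*)\<close>\<close>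

definition Delta_closure ::
    "'e::complex_normed_vector set \<Rightarrow> (('e \<Rightarrow> 'f::complex_normed_vector cdual) \<Rightarrow> complex) set"
  where "Delta_closure U = {w \<in> dual_on (Hinf U) (Hinf_norm U).
    \<forall>e>0. \<exists>u\<in>Delta_tensor U. H_norm U (w - u) < e}"

lemma is_completion_Delta_closure:
  "is_completion (Delta_tensor U) (H_norm U) (Delta_closure U) (H_norm U) (\<lambda>u. u)"
  unfolding Delta_closure_def by (rule is_completion_Delta_tensor)

lemmas cnormed_space_Delta_closure = is_completionD(1)[OF is_completion_Delta_closure]

lemma subspace_Delta_tensor: "complex_vector.subspace (Delta_tensor U)"
  by (simp add: Delta_tensor_def)

lemma delta_tensor_in_Delta_tensor: "x \<in> U \<Longrightarrow> delta_tensor U x y \<in> Delta_tensor U"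
  unfolding Delta_tensor_def by (intro complex_vector.span_base) blast

text \<open>
  Evaluations \<open>k(g) = g(x)\<close> give \<open>\<delta>(x) \<otimes> y\<close>, and \<open>k(g) = Dg(x)h\<close> gives its derivative in
  direction \<open>h\<close>; the common form lets both, and the remainders, be estimated together.  The value
  \<open>0\<close> outside the bounded holomorphic mappings matches the convention for functionals on a carrier.
\<close>

definition tensor_functional ::
    "'e::complex_normed_vector set \<Rightarrow> (('e \<Rightarrow> 'f::complex_normed_vector cdual) \<Rightarrow> 'f cdual) \<Rightarrow>
      'f \<Rightarrow> ('e \<Rightarrow> 'f cdual) \<Rightarrow> complex"
  where "tensor_functional U k y = (\<lambda>g. if g \<in> Hinf U then cdual_apply (k g) y else 0)"

lemma delta_tensor_eq: "delta_tensor U x = tensor_functional U (\<lambda>g. g x)"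
  by (simp add: delta_tensor_def tensor_functional_def fun_eq_iff)

lemma tensor_functional_add: "tensor_functional U k (y + z) = tensor_functional U k y + tensor_functional U k z"
  and tensor_functional_scale: "tensor_functional U k (c *\<^sub>C y) = c *\<^sub>C tensor_functional U k y"
  by (auto simp: tensor_functional_def fun_eq_iff cdual_apply_arg scaleC_fun_def scaleC_complex_def)

lemma H_norm_tensor_functional_le:
  fixes k :: "('e::complex_normed_vector \<Rightarrow> 'f::complex_normed_vector cdual) \<Rightarrow> 'f cdual"
  assumes k: "\<And>g. g \<in> Hinf U \<Longrightarrow> norm (k g) \<le> c * Hinf_norm U g" and c: "0 \<le> c"
  shows "H_norm U (tensor_functional U k y) \<le> c * norm y"
  unfolding H_norm_eq_dual_norm
proof (rule dual_norm_least[OF cnormed_space_Hinf])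
  fix g :: "'e \<Rightarrow> 'f cdual" assume g: "g \<in> Hinf U" "Hinf_norm U g \<le> 1"
  have "norm (k g) \<le> c * 1"
    using k[OF g(1)] mult_left_mono[OF g(2) c] by simp
  then have "norm (k g) * norm y \<le> c * norm y" by (simp add: mult_right_mono)
  with norm_cdual_apply[of "k g" y] g(1)
  show "cmod (tensor_functional U k y g) \<le> c * norm y" by (simp add: tensor_functional_def)
qed

lemma tensor_functional_in_dual:
  fixes k :: "('e::complex_normed_vector \<Rightarrow> 'f::complex_normed_vector cdual) \<Rightarrow> 'f cdual"
  assumes k: "\<And>g. g \<in> Hinf U \<Longrightarrow> norm (k g) \<le> c * Hinf_norm U g" and lin: "clinear_on (Hinf U) k"
  shows "tensor_functional U k y \<in> dual_on (Hinf U) (Hinf_norm U)"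
proof -
  have "cmod (tensor_functional U k y g) \<le> (c * norm y) * Hinf_norm U g" if "g \<in> Hinf U"
    for g :: "'e \<Rightarrow> 'f cdual"
  proof -
    have "norm (k g) * norm y \<le> (c * Hinf_norm U g) * norm y"
      using k[OF that] by (simp add: mult_right_mono)
    with norm_cdual_apply[of "k g" y] that show ?thesis
      by (simp add: tensor_functional_def mult_ac)
  qed
  moreover have "clinear_on (Hinf U) (tensor_functional U k y)"
    using lin by (simp add: clinear_on_def tensor_functional_def scaleC_complex_def
        complex_vector.subspace_add[OF subspace_Hinf] complex_vector.subspace_scale[OF subspace_Hinf])
  ultimately show ?thesis
    unfolding dual_on_def by (auto simp: tensor_functional_def)
qed

lemma clinear_on_frechet_derivative:
  assumes x: "x \<in> U"
  shows "clinear_on (Hinf U :: ('e::complex_normed_vector \<Rightarrow> 'f::complex_normed_vector cdual) set)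
    (\<lambda>g. frechet_derivative g (at x) h)"
proof -
  have "frechet_derivative (f + g) (at x) h = frechet_derivative f (at x) h + frechet_derivative g (at x) h"
    if "f \<in> Hinf U" "g \<in> Hinf U" for f g :: "'e \<Rightarrow> 'f cdual"
    using has_derivative_add[OF Hinf_has_derivative(1)[OF that(1) x] Hinf_has_derivative(1)[OF that(2) x]]
    by (simp add: frechet_derivative_at[symmetric] plus_fun_def)
  moreover have "frechet_derivative (c *\<^sub>C f) (at x) h = c *\<^sub>C frechet_derivative f (at x) h"
    if "f \<in> Hinf U" for c and f :: "'e \<Rightarrow> 'f cdual"
    using bounded_linear.has_derivative[OF bounded_linear_scaleC Hinf_has_derivative(1)[OF that x], of c]
    by (simp add: frechet_derivative_at[symmetric] scaleC_fun_def)
  ultimately show ?thesis by (simp add: clinear_on_def)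
qed

lemma frechet_derivative_scale:
  "g \<in> Hinf U \<Longrightarrow> x \<in> U \<Longrightarrow> frechet_derivative g (at x) (c *\<^sub>C h) = c *\<^sub>C frechet_derivative g (at x) h"
  by (rule clinear_on_scale[OF Hinf_has_derivative(2)]) simp_all

text \<open>
  The difference quotient \<open>(\<delta>(x + th) \<otimes> y - \<delta>(x) \<otimes> y)/t\<close> lies in \<open>\<Delta>(U) \<otimes> F\<close> and, by the
  remainder estimate applied to \<open>th\<close> and divided by \<open>t\<close>, differs from the derivative functional
  by \<open>O(t)\<close> in the norm \<open>H\<close>.
\<close>

lemma derivative_functional_in_Delta_closure:
  fixes y :: "'f::complex_normed_vector" and U :: "'e::complex_normed_vector set"
  assumes r: "0 < r" "ball x r \<subseteq> U"
  shows "tensor_functional U (\<lambda>g. frechet_derivative g (at x) h) y \<in> Delta_closure U"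
proof -
  let ?T = "tensor_functional U (\<lambda>g. frechet_derivative g (at x) h) y"
  have x: "x \<in> U" using r by auto
  have "?T \<in> dual_on (Hinf U) (Hinf_norm U)"
    by (rule tensor_functional_in_dual[OF Hinf_Cauchy_estimates(1)[OF _ r] clinear_on_frechet_derivative[OF x]])
  moreover have "\<exists>u\<in>Delta_tensor U. H_norm U (?T - u) < e" if e: "e > 0" for e
  proof -
    define A where "A = 8 / r\<^sup>2 * (norm h)\<^sup>2"
    have A: "A \<ge> 0" by (simp add: A_def)
    \<comment> \<open>The first bound puts \<open>th\<close> in the range of the remainder estimate, the second makes the
      resulting error \<open>tA\<parallel>y\<parallel>\<close> smaller than \<open>e\<close>; the added ones keep the denominators positive.\<close>
    define t where "t = min (r / (4 * (norm h + 1))) (e / (2 * (A * norm y + 1)))"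
    have t: "t > 0" using r(1) e A by (simp add: t_def add_nonneg_pos)
    have "t \<le> r / (4 * (norm h + 1))" by (simp add: t_def)
    then have "t * (4 * (norm h + 1)) \<le> r"
      by (subst (asm) pos_le_divide_eq) (simp_all add: add_nonneg_pos)
    moreover have "t * (4 * (norm h + 1)) = 4 * (t * norm h) + 4 * t" by (simp add: algebra_simps)
    ultimately have small: "t * norm h < r / 2"
      using t r(1) mult_nonneg_nonneg[of t "norm h"] by linarith
    have "t \<le> e / (2 * (A * norm y + 1))" by (simp add: t_def)
    then have "t * (2 * (A * norm y + 1)) \<le> e"
      using A by (subst (asm) pos_le_divide_eq) (simp_all add: add_nonneg_pos)
    moreover have "t * (2 * (A * norm y + 1)) = 2 * (t * A * norm y) + 2 * t" by (simp add: algebra_simps)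
    moreover have "0 \<le> t * A * norm y" using t A by simp
    ultimately have lt: "t * A * norm y < e" using t by linarith
    let ?h = "complex_of_real t *\<^sub>C h"
    have nh: "norm ?h = t * norm h" using t by (simp add: norm_scaleC)
    have xh: "x + ?h \<in> U" using r small nh t by (intro subsetD[OF r(2)]) (simp add: dist_norm)
    define u where "u = complex_of_real (1 / t) *\<^sub>C (delta_tensor U (x + ?h) y - delta_tensor U x y)"
    have "u \<in> Delta_tensor U"
      unfolding u_def using x xh
      by (intro complex_vector.subspace_scale[OF subspace_Delta_tensor]
          complex_vector.subspace_diff[OF subspace_Delta_tensor] delta_tensor_in_Delta_tensor)
    moreover have "H_norm U (?T - u) < e"
    proof -
      let ?k = "\<lambda>g :: 'e \<Rightarrow> 'f cdual. complex_of_real (- (1 / t)) *\<^sub>C (g (x + ?h) - g x - frechet_derivative g (at x) ?h)"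
      have eq: "?T - u = tensor_functional U ?k y"
        using t by (auto simp: fun_eq_iff u_def tensor_functional_def delta_tensor_def scaleC_fun_def
            scaleC_complex_def cdual_apply_diff frechet_derivative_scale[OF _ x] field_simps)
      have "norm (?k g) \<le> (t * A) * Hinf_norm U g" if g: "g \<in> Hinf U" for g
      proof -
        have "norm (?k g) = 1 / t * norm (g (x + ?h) - g x - frechet_derivative g (at x) ?h)"
          using t by (simp only: norm_scaleC norm_of_real) simp
        also have "\<dots> \<le> 1 / t * (8 / r\<^sup>2 * (norm ?h)\<^sup>2 * Hinf_norm U g)"
          using t small nh by (intro mult_left_mono Hinf_Cauchy_estimates(2)[OF g r]) auto
        also have "\<dots> = (t * A) * Hinf_norm U g"
          using t unfolding nh by (simp add: A_def power2_eq_square)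
        finally show ?thesis .
      qed
      then have "H_norm U (tensor_functional U ?k y) \<le> (t * A) * norm y"
        using t A by (intro H_norm_tensor_functional_le) auto
      with lt eq show ?thesis by simp
    qed
    ultimately show ?thesis by blast
  qed
  ultimately show ?thesis by (simp add: Delta_closure_def)
qed


section \<open>Functionals on the closure are bounded holomorphic mappings\<close>

text \<open>
  The image of \<open>\<Phi>\<close> under the transpose of \<open>y \<mapsto> k \<otimes> y\<close>.  It is meaningful when \<open>k\<close> is bounded and
  all \<open>k \<otimes> y\<close> lie in the domain of \<open>\<Phi>\<close>; otherwise \<open>Abs_cdual\<close> may be applied outside its
  domain.
\<close>

definition tensor_adjoint ::
    "((('e \<Rightarrow> 'f cdual) \<Rightarrow> complex) \<Rightarrow> complex) \<Rightarrow> 'e::complex_normed_vector set \<Rightarrow>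
      (('e \<Rightarrow> 'f::complex_normed_vector cdual) \<Rightarrow> 'f cdual) \<Rightarrow> 'f cdual"
  where "tensor_adjoint \<Phi> U k = Abs_cdual (\<lambda>y. \<Phi> (tensor_functional U k y))"

lemma dual_Delta_closure_tensor_le:
  assumes \<Phi>: "\<Phi> \<in> dual_on (Delta_closure U) (H_norm U)"
    and mem: "tensor_functional U k y \<in> Delta_closure U"
    and k: "\<And>g. g \<in> Hinf U \<Longrightarrow> norm (k g) \<le> c * Hinf_norm U g" and c: "0 \<le> c"
  shows "cmod (\<Phi> (tensor_functional U k y)) \<le> dual_norm (Delta_closure U) (H_norm U) \<Phi> * c * norm y"
proof -
  have "cmod (\<Phi> (tensor_functional U k y))
      \<le> dual_norm (Delta_closure U) (H_norm U) \<Phi> * H_norm U (tensor_functional U k y)"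
    by (rule dual_norm_apply[OF cnormed_space_Delta_closure \<Phi> mem])
  also have "\<dots> \<le> dual_norm (Delta_closure U) (H_norm U) \<Phi> * (c * norm y)"
    by (intro mult_left_mono H_norm_tensor_functional_le k c
        dual_norm_nonneg[OF cnormed_space_Delta_closure \<Phi>])
  finally show ?thesis by (simp add: mult.assoc)
qed

lemma tensor_adjoint_apply:
  assumes \<Phi>: "\<Phi> \<in> dual_on (Delta_closure U) (H_norm U)"
    and mem: "\<And>y. tensor_functional U k y \<in> Delta_closure U"
    and k: "\<And>g. g \<in> Hinf U \<Longrightarrow> norm (k g) \<le> c * Hinf_norm U g" and c: "0 \<le> c"
  shows "cdual_apply (tensor_adjoint \<Phi> U k) y = \<Phi> (tensor_functional U k y)"
proof -
  have "clinear_on UNIV (\<lambda>y. \<Phi> (tensor_functional U k y))"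
    using dual_on_D(1)[OF \<Phi>] mem
    by (simp add: clinear_on_def tensor_functional_add tensor_functional_scale)
  from cdual_apply_Abs[OF this dual_Delta_closure_tensor_le[OF \<Phi> mem k c]]
  show ?thesis by (simp add: tensor_adjoint_def)
qed

text \<open>
  The mapping is differentiable at \<open>x\<close> because \<open>\<Phi>\<close> turns the uniform bounds for
  \<open>g \<mapsto> Dg(x)h\<close> and \<open>g \<mapsto> g(x + h) - g(x) - Dg(x)h\<close> into bounds in the dual of \<open>F\<close>: the former makes
  the candidate derivative continuous, the latter makes the remainder quadratic in \<open>h\<close>.
\<close>

lemma tensor_adjoint_evaluation_in_Hinf:
  fixes U :: "'e::complex_normed_vector set"
    and \<Phi> :: "(('e \<Rightarrow> 'f::complex_normed_vector cdual) \<Rightarrow> complex) \<Rightarrow> complex"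
  assumes U: "open U" and \<Phi>: "\<Phi> \<in> dual_on (Delta_closure U) (H_norm U)"
  shows "(\<lambda>x. if x \<in> U then tensor_adjoint \<Phi> U (\<lambda>g. g x) else 0) \<in> Hinf U"
    and "x \<in> U \<Longrightarrow> cdual_apply (tensor_adjoint \<Phi> U (\<lambda>g. g x)) y = \<Phi> (delta_tensor U x y)"
proof -
  let ?W = "Delta_closure U :: (('e \<Rightarrow> 'f cdual) \<Rightarrow> complex) set"
  let ?N = "dual_norm ?W (H_norm U) \<Phi>"
  note W = cnormed_space_Delta_closure
  note subW = cnormed_space_onD(1)[OF W]
  note lin = dual_on_D(1)[OF \<Phi>]
  have N: "?N \<ge> 0" by (rule dual_norm_nonneg[OF W \<Phi>])
  have ev_W: "tensor_functional U (\<lambda>g. g x) y \<in> ?W" if "x \<in> U" for x and y :: 'f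
    using is_completionD(2)[OF is_completion_Delta_closure delta_tensor_in_Delta_tensor[OF that, of y]]
    by (simp add: delta_tensor_eq)
  have ev_bound: "norm (g x) \<le> 1 * Hinf_norm U g" if "g \<in> Hinf U" for g :: "'e \<Rightarrow> 'f cdual" and x
    using Hinf_norm_upper[OF that] by simp
  have ev: "cdual_apply (tensor_adjoint \<Phi> U (\<lambda>g. g x)) y = \<Phi> (tensor_functional U (\<lambda>g. g x) y)"
    if "x \<in> U" for x y
    by (rule tensor_adjoint_apply[OF \<Phi> ev_W[OF that] ev_bound]) simp_all
  then show "x \<in> U \<Longrightarrow> cdual_apply (tensor_adjoint \<Phi> U (\<lambda>g. g x)) y = \<Phi> (delta_tensor U x y)"
    by (simp add: delta_tensor_eq)
  define f where "f x = (if x \<in> U then tensor_adjoint \<Phi> U (\<lambda>g. g x) else 0)" for x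
  have "norm (f x) \<le> ?N" if "x \<in> U" for x
  proof (rule norm_cdual_le[OF N])
    show "cmod (cdual_apply (f x) y) \<le> ?N * norm y" for y
      using dual_Delta_closure_tensor_le[OF \<Phi> ev_W[OF that] ev_bound, of y] ev[OF that, of y] that
      by (simp add: f_def)
  qed
  then have bdd: "bounded (f ` U)" by (auto simp: bounded_iff)
  have "\<exists>D. clinear_on UNIV D \<and> (f has_derivative D) (at x)" if x: "x \<in> U" for x
  proof -
    obtain r where r: "0 < r" "ball x r \<subseteq> U" using U x open_contains_ball by blast
    let ?d = "\<lambda>h (g :: 'e \<Rightarrow> 'f cdual). frechet_derivative g (at x) h"
    define D where "D h = tensor_adjoint \<Phi> U (?d h)" for h
    note d_W = derivative_functional_in_Delta_closure[OF r]
    have c0: "0 \<le> 2 / r * norm h" for h :: 'e using r(1) by simp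
    note d_bound = Hinf_Cauchy_estimates(1)[OF _ r]
    have D: "cdual_apply (D h) y = \<Phi> (tensor_functional U (?d h) y)" for h y
      unfolding D_def by (rule tensor_adjoint_apply[OF \<Phi> d_W d_bound c0])
    have tf_add: "tensor_functional U (?d (h + h')) y = tensor_functional U (?d h) y + tensor_functional U (?d h') y"
      and tf_scale: "tensor_functional U (?d (c *\<^sub>C h)) y = c *\<^sub>C tensor_functional U (?d h) y"
      for h h' c and y :: 'f
      by (auto simp: tensor_functional_def fun_eq_iff scaleC_fun_def scaleC_complex_def
          clinear_on_add[OF Hinf_has_derivative(2)[OF _ x]] frechet_derivative_scale[OF _ x])
    have D_lin: "clinear_on UNIV D"
      unfolding clinear_on_def
      using clinear_on_add[OF lin d_W d_W] clinear_on_scale[OF lin d_W]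
      by (auto intro!: cdual_eqI simp: D tf_add tf_scale scaleC_complex_def)
    have D_bound: "norm (D h) \<le> ?N * (2 / r) * norm h" for h
    proof (rule norm_cdual_le)
      show "cmod (cdual_apply (D h) y) \<le> ?N * (2 / r) * norm h * norm y" for y
        using dual_Delta_closure_tensor_le[OF \<Phi> d_W d_bound c0, of h y] by (simp add: D mult_ac)
    qed (use N r(1) in simp)
    have bl: "bounded_linear D"
      using D_lin D_bound
      by (intro bounded_linear_intro[of _ "?N * (2 / r)"])
        (simp_all add: clinear_on_def scaleR_scaleC mult.commute)
    define A where "A = ?N * (8 / r\<^sup>2)"
    have A: "A \<ge> 0" using N by (simp add: A_def)
    have rem: "norm (f (x + h) - f x - D h) \<le> A * (norm h)\<^sup>2" if h: "norm h < r / 2" for h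
    proof (rule norm_cdual_le)
      fix y
      let ?k = "\<lambda>g :: 'e \<Rightarrow> 'f cdual. g (x + h) - g x - ?d h g"
      have xh: "x + h \<in> U" using r(1) h by (intro subsetD[OF r(2)]) (simp add: dist_norm)
      have split: "tensor_functional U ?k y = tensor_functional U (\<lambda>g. g (x + h)) y
          - tensor_functional U (\<lambda>g. g x) y - tensor_functional U (?d h) y"
        by (simp add: tensor_functional_def fun_eq_iff cdual_apply_diff)
      have mem: "tensor_functional U ?k y \<in> ?W"
        unfolding split by (intro complex_vector.subspace_diff[OF subW] ev_W xh x d_W)
      have "cdual_apply (f (x + h) - f x - D h) y = \<Phi> (tensor_functional U ?k y)"
        unfolding split
        by (simp add: clinear_on_diff[OF lin subW] complex_vector.subspace_diff[OF subW] ev_W xh x d_W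
            cdual_apply_diff D f_def ev)
      also have "cmod \<dots> \<le> ?N * (8 / r\<^sup>2 * (norm h)\<^sup>2) * norm y"
        by (rule dual_Delta_closure_tensor_le[OF \<Phi> mem Hinf_Cauchy_estimates(2)[OF _ r h]]) simp_all
      finally show "cmod (cdual_apply (f (x + h) - f x - D h) y) \<le> A * (norm h)\<^sup>2 * norm y"
        by (simp add: A_def mult.assoc)
    qed (use A in simp)
    have "(\<lambda>h. norm (f (x + h) - f x - D h) / norm h) \<midarrow>0\<rightarrow> 0"
    proof (rule Lim_null_comparison)
      have "eventually (\<lambda>h :: 'e. norm h < r / 2) (at 0)"
        using r(1) by (auto simp: eventually_at dist_norm intro!: exI[of _ "r / 2"])
      then show "eventually (\<lambda>h. norm (norm (f (x + h) - f x - D h) / norm h) \<le> A * norm h) (at 0)"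
      proof eventually_elim
        case (elim h)
        then show ?case using rem[OF elim] A
          by (cases "h = 0") (simp_all add: divide_le_eq power2_eq_square mult.assoc)
      qed
      have "(\<lambda>h :: 'e. A * norm h) \<midarrow>0\<rightarrow> A * norm (0 :: 'e)" by (intro tendsto_intros)
      then show "(\<lambda>h :: 'e. A * norm h) \<midarrow>0\<rightarrow> 0" by simp
    qed
    with bl D_lin show ?thesis unfolding has_derivative_at by blast
  qed
  then have "f \<in> Hinf U" using bdd by (simp add: Hinf_def cholomorphic_on_def f_def)
  then show "(\<lambda>x. if x \<in> U then tensor_adjoint \<Phi> U (\<lambda>g. g x) else 0) \<in> Hinf U"
    unfolding f_def[abs_def] .
qed

text \<open>
  A functional on an arbitrary completion is moved to the closure in the dual, where the
  derivative functionals live, by restricting it to \<open>\<Delta>(U) \<otimes> F\<close> and extending again.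
\<close>

lemma Hinf_represents_functional:
  fixes U :: "'e::complex_normed_vector set"
    and \<iota> :: "(('e \<Rightarrow> 'f::complex_normed_vector cdual) \<Rightarrow> complex) \<Rightarrow> 'c::complex_vector"
  assumes U: "open U" and comp: "is_completion (Delta_tensor U) (H_norm U) C M \<iota>"
    and \<phi>: "\<phi> \<in> dual_on C M"
  shows "\<exists>f\<in>Hinf U. \<forall>x\<in>U. \<forall>y. cdual_apply (f x) y = \<phi> (\<iota> (delta_tensor U x y))"
proof -
  note C = is_completionD(1)[OF comp]
  have "clinear_on (Delta_tensor U) (\<lambda>u. \<phi> (\<iota> u))"
    using is_completionD(2,3)[OF comp] dual_on_D(1)[OF \<phi>]
    by (simp add: clinear_on_def)
  moreover have "cmod (\<phi> (\<iota> u)) \<le> dual_norm C M \<phi> * H_norm U u" if "u \<in> Delta_tensor U" for u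
    using dual_norm_apply[OF C \<phi> is_completionD(2)[OF comp that]] is_completionD(4)[OF comp that]
    by simp
  ultimately obtain \<Phi> where \<Phi>: "\<Phi> \<in> dual_on (Delta_closure U) (H_norm U)"
      "\<And>u. u \<in> Delta_tensor U \<Longrightarrow> \<Phi> u = \<phi> (\<iota> u)"
    using dual_on_completion_extend[OF is_completion_Delta_closure subspace_Delta_tensor,
        where \<psi> = "\<lambda>u. \<phi> (\<iota> u)" and K = "dual_norm C M \<phi>"] dual_norm_nonneg[OF C \<phi>] by blast
  show ?thesis
    using tensor_adjoint_evaluation_in_Hinf[OF U \<Phi>(1)] \<Phi>(2)[OF delta_tensor_in_Delta_tensor]
    by (intro bexI[of _ "\<lambda>x. if x \<in> U then tensor_adjoint \<Phi> U (\<lambda>g. g x) else 0"]) simp_all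
qed


section \<open>The isometric isomorphism\<close>

lemma apply_sum_delta_tensor:
  assumes "f \<in> Hinf U"
  shows "(\<Sum>i\<in>I. lam i *\<^sub>C delta_tensor U (x i) (y i)) f = (\<Sum>i\<in>I. lam i * cdual_apply (f (x i)) (y i))"
  using assms
  by (induction I rule: infinite_finite_induct)
    (simp_all add: scaleC_fun_def scaleC_complex_def delta_tensor_def)

theorem corollary4p2:
  fixes U :: "'e::cbanach set"
    and C :: "'c::complex_vector set"
    and M :: "'c \<Rightarrow> real"
    and \<iota> :: "(('e \<Rightarrow> 'f::cbanach cdual) \<Rightarrow> complex) \<Rightarrow> 'c"
  assumes "open U"
    and "is_completion (Delta_tensor U) (H_norm U) C M \<iota>"
  shows "\<exists>\<Lambda> :: ('e \<Rightarrow> 'f cdual) \<Rightarrow> ('c \<Rightarrow> complex).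
    isometric_isomorphism (Hinf U) (Hinf_norm U) (dual_on C M) (dual_norm C M) \<Lambda> \<and>
    (\<forall>f\<in>Hinf U. \<forall>(n::nat) (lam::nat \<Rightarrow> complex) (x::nat \<Rightarrow> 'e) (y::nat \<Rightarrow> 'f).
      (\<forall>i\<in>{1..n}. x i \<in> U) \<longrightarrow>
      \<Lambda> f (\<iota> (\<Sum>i=1..n. lam i *\<^sub>C delta_tensor U (x i) (y i))) =
        (\<Sum>i=1..n. lam i * cdual_apply (f (x i)) (y i))) \<and>
    (\<forall>\<phi>\<in>dual_on C M. \<forall>x\<in>U. \<forall>y::'f.
      cdual_apply (inv_into (Hinf U) \<Lambda> \<phi> x) y = \<phi> (\<iota> (delta_tensor U x y)))"
proof -
  let ?H = "Hinf U :: ('e \<Rightarrow> 'f cdual) set"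
  note comp = assms(2)
  note C = is_completionD(1)[OF comp]
  note subH = subspace_Hinf[of U, where ?'b = "'f cdual"]
  have "\<exists>\<phi>\<in>dual_on C M. (\<forall>u\<in>Delta_tensor U. \<phi> (\<iota> u) = u f) \<and> dual_norm C M \<phi> \<le> Hinf_norm U f"
    if f: "f \<in> ?H" for f
  proof (rule dual_on_completion_extend[OF comp subspace_Delta_tensor])
    show "clinear_on (Delta_tensor U) (\<lambda>u. u f)"
      by (simp add: clinear_on_def scaleC_fun_def)
    show "0 \<le> Hinf_norm U f" by (rule Hinf_norm_nonneg[OF f])
    fix u :: "('e \<Rightarrow> 'f cdual) \<Rightarrow> complex" assume "u \<in> Delta_tensor U"
    then show "cmod (u f) \<le> Hinf_norm U f * H_norm U u"
      using dual_norm_apply[OF cnormed_space_Hinf _ f] Delta_tensor_subset_dual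
      by (auto simp: H_norm_eq_dual_norm mult.commute)
  qed
  then obtain \<Lambda> where \<Lambda>: "\<And>f. f \<in> ?H \<Longrightarrow> \<Lambda> f \<in> dual_on C M"
      "\<And>f u. f \<in> ?H \<Longrightarrow> u \<in> Delta_tensor U \<Longrightarrow> \<Lambda> f (\<iota> u) = u f"
      "\<And>f. f \<in> ?H \<Longrightarrow> dual_norm C M (\<Lambda> f) \<le> Hinf_norm U f"
    by metis
  have \<Lambda>_delta: "\<Lambda> f (\<iota> (delta_tensor U x y)) = cdual_apply (f x) y" if "f \<in> ?H" "x \<in> U" for f x y
    using \<Lambda>(2)[OF that(1) delta_tensor_in_Delta_tensor[OF that(2)]] that by (simp add: delta_tensor_def)
  have lin: "clinear_on ?H \<Lambda>"
    unfolding clinear_on_def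
  proof (intro conjI ballI allI)
    fix f g c assume f: "f \<in> ?H"
    have cf: "c *\<^sub>C f \<in> ?H" by (rule complex_vector.subspace_scale[OF subH f])
    show "\<Lambda> (c *\<^sub>C f) = c *\<^sub>C \<Lambda> f"
    proof (rule dual_on_completion_eqI[OF comp \<Lambda>(1)[OF cf]])
      show "c *\<^sub>C \<Lambda> f \<in> dual_on C M"
        by (rule complex_vector.subspace_scale[OF subspace_dual_on \<Lambda>(1)[OF f]])
      fix u :: "('e \<Rightarrow> 'f cdual) \<Rightarrow> complex" assume u: "u \<in> Delta_tensor U"
      then have "clinear_on ?H u" using Delta_tensor_subset_dual dual_on_D(1) by blast
      then show "\<Lambda> (c *\<^sub>C f) (\<iota> u) = (c *\<^sub>C \<Lambda> f) (\<iota> u)"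
        using f by (simp add: \<Lambda>(2)[OF cf u] \<Lambda>(2)[OF f u] scaleC_fun_def[of c "\<Lambda> f"] clinear_on_scale)
    qed
    assume g: "g \<in> ?H"
    have fg: "f + g \<in> ?H" by (rule complex_vector.subspace_add[OF subH f g])
    show "\<Lambda> (f + g) = \<Lambda> f + \<Lambda> g"
    proof (rule dual_on_completion_eqI[OF comp \<Lambda>(1)[OF fg]])
      show "\<Lambda> f + \<Lambda> g \<in> dual_on C M"
        by (rule complex_vector.subspace_add[OF subspace_dual_on \<Lambda>(1)[OF f] \<Lambda>(1)[OF g]])
      fix u :: "('e \<Rightarrow> 'f cdual) \<Rightarrow> complex" assume u: "u \<in> Delta_tensor U"
      then have "clinear_on ?H u" using Delta_tensor_subset_dual dual_on_D(1) by blast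
      then show "\<Lambda> (f + g) (\<iota> u) = (\<Lambda> f + \<Lambda> g) (\<iota> u)"
        using f g by (simp add: \<Lambda>(2)[OF fg u] \<Lambda>(2)[OF f u] \<Lambda>(2)[OF g u] clinear_on_add)
    qed
  qed
  have isom: "dual_norm C M (\<Lambda> f) = Hinf_norm U f" if f: "f \<in> ?H" for f
  proof (rule antisym[OF \<Lambda>(3)[OF f]])
    have N: "0 \<le> dual_norm C M (\<Lambda> f)" by (rule dual_norm_nonneg[OF C \<Lambda>(1)[OF f]])
    show "Hinf_norm U f \<le> dual_norm C M (\<Lambda> f)"
    proof (rule Hinf_norm_least[OF N], rule norm_cdual_le[OF N])
      fix x y assume x: "x \<in> U"
      note \<delta> = delta_tensor_in_Delta_tensor[OF x, of y]
      have "cmod (cdual_apply (f x) y) \<le> dual_norm C M (\<Lambda> f) * H_norm U (delta_tensor U x y)"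
        using dual_norm_apply[OF C \<Lambda>(1)[OF f] is_completionD(2)[OF comp \<delta>]]
        by (simp add: \<Lambda>_delta[OF f x] is_completionD(4)[OF comp \<delta>])
      also have "\<dots> \<le> dual_norm C M (\<Lambda> f) * (1 * norm y)"
        unfolding delta_tensor_eq
        by (intro mult_left_mono[OF _ N] H_norm_tensor_functional_le) (simp_all add: Hinf_norm_upper)
      finally show "cmod (cdual_apply (f x) y) \<le> dual_norm C M (\<Lambda> f) * norm y" by simp
    qed
  qed
  have inj: "inj_on \<Lambda> ?H"
  proof (rule inj_onI, rule ext, rule cdual_eqI)
    fix f g x y assume "f \<in> ?H" "g \<in> ?H" "\<Lambda> f = \<Lambda> g"
    then show "cdual_apply (f x) y = cdual_apply (g x) y"
      using \<Lambda>_delta[of f x y] \<Lambda>_delta[of g x y] by (cases "x \<in> U") (auto simp: Hinf_def)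
  qed
  have surj: "\<phi> \<in> \<Lambda> ` ?H" if \<phi>: "\<phi> \<in> dual_on C M" for \<phi>
  proof -
    obtain f where f: "f \<in> ?H" "\<And>x y. x \<in> U \<Longrightarrow> cdual_apply (f x) y = \<phi> (\<iota> (delta_tensor U x y))"
      using Hinf_represents_functional[OF assms \<phi>] by blast
    have "\<phi> = \<Lambda> f"
    proof (rule dual_on_completion_eqI[OF comp \<phi> \<Lambda>(1)[OF f(1)]])
      fix u :: "('e \<Rightarrow> 'f cdual) \<Rightarrow> complex" assume u: "u \<in> Delta_tensor U"
      have pull: "clinear_on (Delta_tensor U) (\<lambda>u. \<psi> (\<iota> u))" if "\<psi> \<in> dual_on C M" for \<psi>
        using is_completionD(2,3)[OF comp] dual_on_D(1)[OF that] by (simp add: clinear_on_def)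
      show "\<phi> (\<iota> u) = \<Lambda> f (\<iota> u)"
      proof (rule clinear_on_span_eqI[where p = "\<lambda>u. \<phi> (\<iota> u)" and q = "\<lambda>u. \<Lambda> f (\<iota> u)"])
        show "u \<in> complex_vector.span {delta_tensor U x y | x y. x \<in> U}"
          using u by (simp add: Delta_tensor_def)
      qed (use pull[OF \<phi>] pull[OF \<Lambda>(1)[OF f(1)]] f \<Lambda>_delta[OF f(1)] in
          \<open>auto simp: Delta_tensor_def\<close>)
    qed
    with f(1) show ?thesis by blast
  qed
  have bij: "bij_betw \<Lambda> ?H (dual_on C M)"
    unfolding bij_betw_def using inj surj \<Lambda>(1) by blast
  have sums: "\<Lambda> f (\<iota> (\<Sum>i=1..n. lam i *\<^sub>C delta_tensor U (x i) (y i))) =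
      (\<Sum>i=1..n. lam i * cdual_apply (f (x i)) (y i))"
    if "f \<in> ?H" "\<forall>i\<in>{1..n}. x i \<in> U" for f n lam x y
  proof -
    have "(\<Sum>i=1..n. lam i *\<^sub>C delta_tensor U (x i) (y i)) \<in> Delta_tensor U"
      using that(2)
      by (intro complex_vector.subspace_sum[OF subspace_Delta_tensor]
          complex_vector.subspace_scale[OF subspace_Delta_tensor] delta_tensor_in_Delta_tensor) auto
    then show ?thesis using \<Lambda>(2)[OF that(1)] by (simp add: apply_sum_delta_tensor[OF that(1)])
  qed
  have inverse: "cdual_apply (inv_into ?H \<Lambda> \<phi> x) y = \<phi> (\<iota> (delta_tensor U x y))"
    if "\<phi> \<in> dual_on C M" "x \<in> U" for \<phi> x y
    using \<Lambda>_delta[OF inv_into_into[OF surj[OF that(1)]] that(2)] f_inv_into_f[OF surj[OF that(1)]]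
    by simp
  have iso: "isometric_isomorphism ?H (Hinf_norm U) (dual_on C M) (dual_norm C M) \<Lambda>"
    unfolding isometric_isomorphism_def using lin bij isom by blast
  show ?thesis
    by (intro exI[of _ \<Lambda>] conjI ballI allI impI) (assumption | rule iso sums inverse)+
qed

end
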